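(* Let $t$ be an RGA term. If $\emptyset\vdash t\,\mathsf N$ is derivable, then $t\Downarrow_s k$ for some step index $s\in\mathbb N$ and some natural number $k$.
   Context: **Terms.** Raw terms are: variables $v_i$ ($i\in\mathbb N$, de Bruijn indices), and operator nodes, each consisting of an operator code, a binder count $k\in\mathbb N$ and a finite list of raw terms as arguments, in each of which the $k$ lowest indices are bound. RGA has ten operators: constants $\bot$, $\mathbf 0$, $\mathcal R$ (recursor), $\mathcal A$ (universal quantifier combinator); unary $\mathbf S$, $\neg$; unary $\lambda$ (binder count 1, the only binder); binary $=$, $\lor$, and application $\cdot$ (left associative). A term $t$ is well-formed, $\mathrm{wf}(t)$, iff it is built from variables and these ten operators at these arities and binder counts. "Term" means raw term; formulas are just terms. Closed means having no free variables. $\underline n=\mathbf S^n\mathbf 0$ is the numeral of $n$. $[v_i\mapsto s]t$ (also $[i\mapsto s]t$): capture-avoiding replacement of the free variable $v_i$ by $s$, other free variables unchanged. $b[t]$: $\beta$-instance, replacing index $0$ in $b$ by $t$ and decrementing all other free indices. $\uparrow t$: all free indices increased by one; $\uparrow\Gamma$ elementwise. $\mathrm{fv}$: set of free variables. Abbreviations: $t\neq u:=\neg(t=u)$; $t\,\mathsf N:=(t=t)$; $t\,\mathsf B:=(t\lor\neg t)$; $t\land u:=\neg(\neg t\lor\neg u)$. **Head steps** $t\triangleright t'$ (syntactic relation): $(\lambda b)\cdot t\triangleright b[t]$ if $\mathrm{wf}(t)$; $\mathcal R\cdot g\cdot h\cdot\mathbf 0\triangleright g$ if $\mathrm{wf}(h)$;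 $\mathcal R\cdot g\cdot h\cdot(\mathbf S\,\underline n)\triangleright h\cdot\underline n\cdot(\mathcal R\cdot g\cdot h\cdot\underline n)$ if $\mathrm{wf}(g)$; and $t\cdot u\triangleright t'\cdot u$ if $t\triangleright t'$. **Proofs.** A judgment $\Gamma\vdash c$ has a finite set $\Gamma$ of terms and a term $c$. A proof is a finite list of judgments each following from earlier entries by one rule below; $P\rhd(\Gamma\vdash c)$ means $P$ is a valid proof containing $\Gamma\vdash c$; a judgment is derivable if some proof contains it. Writing $\Gamma\vdash c$ as an assertion means derivability. Rules ($\Rightarrow$ from premises to conclusion, $\Leftrightarrow$ both directions): Structural: $\mathrm{wf}(c)\Rightarrow\Gamma,c\vdash c$; $\Gamma\vdash c\Rightarrow\Gamma,a\vdash c$; $\Gamma\vdash a$ and $\Gamma,a\vdash c\Rightarrow\Gamma\vdash c$; $\Gamma\vdash c$ with $\Gamma,c,s$ well-formed $\Rightarrow[v\mapsto s]\Gamma\vdash[v\mapsto s]c$. Truth values: $\Gamma\vdash a\Leftrightarrow\Gamma\vdash a=\underline 1$; $\Gamma\vdash\neg a\Leftrightarrow\Gamma\vdash a=\underline 0$. Negation: $\Gamma\vdash\neg a$, $\Gamma\vdash a$, $\mathrm{wf}(c)\Rightarrow\Gamma\vdash c$; $\Gamma\vdash a\Leftrightarrow\Gamma\vdash\neg\neg a$. Disjunction: $\Gamma\vdash a$, $\mathrm{wf}(b)\Rightarrow\Gamma\vdash a\lor b$; $\Gamma\vdash b$, $\mathrm{wf}(a)\Rightarrow\Gamma\vdash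 a\lor b$; $\Gamma\vdash\neg a$, $\Gamma\vdash\neg b\Rightarrow\Gamma\vdash\neg(a\lor b)$; $\Gamma\vdash a\lor b$, $\Gamma,a\vdash c$, $\Gamma,b\vdash c\Rightarrow\Gamma\vdash c$; $\Gamma\vdash\neg(a\lor b)\Rightarrow\Gamma\vdash\neg a$, and $\Rightarrow\Gamma\vdash\neg b$. Equality: $\Gamma\vdash a\,\mathsf N\Leftrightarrow\Gamma\vdash a=a$; $\Gamma\vdash a=b\Rightarrow\Gamma\vdash b=a$; $\Gamma\vdash a=b$, $\Gamma\vdash[v\mapsto a]p$, $\mathrm{wf}(p)\Rightarrow\Gamma\vdash[v\mapsto b]p$; $\Gamma\vdash a\ne b\Rightarrow\Gamma\vdash b\ne a$; $\Gamma\vdash a\,\mathsf N$, $\Gamma\vdash b\,\mathsf N\Rightarrow\Gamma\vdash(a=b)\,\mathsf B$; $\Gamma\vdash(a=b)\,\mathsf B\Rightarrow\Gamma\vdash(a\,\mathsf N)\land(b\,\mathsf N)$. Naturals: $\Gamma\vdash\mathbf 0\,\mathsf N$; $\Gamma\vdash a\,\mathsf N\Leftrightarrow\Gamma\vdash\mathbf S a\,\mathsf N$; $\Gamma\vdash a\,\mathsf N\Rightarrow\Gamma\vdash\mathbf S a\ne\mathbf 0$; $\Gamma\vdash a\ne b\Leftrightarrow\Gamma\vdash\mathbf S a\ne\mathbf S b$; $\Gamma\vdash\mathbf S a=\mathbf S b\Rightarrow\Gamma\vdash a=b$; $\Gamma\vdash\bot\,\mathsf N$, $\mathrm{wf}(p)\Rightarrow\Gamma\vdash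 p$. Induction: $\Gamma\vdash[i\mapsto\mathbf 0]c$; $v_i\,\mathsf N,c,\Gamma\vdash[i\mapsto\mathbf S v_i]c$; $\Gamma\vdash a\,\mathsf N$; $\mathrm{wf}(c)$; $i\notin\mathrm{fv}(\Gamma)$ $\Rightarrow\Gamma\vdash[i\mapsto a]c$. Conversion: if $c\triangleright c'$: $\Gamma\vdash c'\Leftrightarrow\Gamma\vdash c$; $\Gamma\vdash c'\,\mathsf N\Rightarrow\Gamma\vdash c=c'$. Recursor: $\Gamma\vdash m\,\mathsf N$, $\Gamma\vdash(h\cdot m\cdot(\mathcal R\cdot g\cdot h\cdot m))\,\mathsf N$, $\mathrm{wf}(g)\Rightarrow\Gamma\vdash\mathcal R\cdot g\cdot h\cdot(\mathbf S m)=h\cdot m\cdot(\mathcal R\cdot g\cdot h\cdot m)$. Quantifier: $v_0\,\mathsf N,\uparrow\Gamma\vdash\uparrow f\cdot v_0\Rightarrow\Gamma\vdash\mathcal A\cdot f$; $\Gamma\vdash\mathcal A\cdot f$, $\Gamma\vdash a\,\mathsf N\Rightarrow\Gamma\vdash f\cdot a$; $\Gamma\vdash\neg(f\cdot a)$, $\Gamma\vdash a\,\mathsf N\Rightarrow\Gamma\vdash\neg(\mathcal A\cdot f)$; $\Gamma\vdash\neg(\mathcal A\cdot f)$ and $v_0\,\mathsf N,\neg(\uparrow f\cdot v_0),\uparrow\Gamma\vdash\uparrow c\Rightarrow\Gamma\vdash c$. **Evaluation.** Fix a standard effective injective Gödel coding $P\mapsto\ulcorner P\urcorner\in\mathbb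 N$ of proofs. Let $\mathsf{tt}=1$, $\mathsf{ff}=0$. Head shapes $w$ are: $\lambda b$; $\mathcal R$; $\mathcal R\,g$; $\mathcal R\,g\,h$; $\mathcal A$. Value evaluation $t\Downarrow_s r$ ($r,s\in\mathbb N$) and head evaluation $t\Downarrow^{\mathrm{hd}}_s w$ are the least relations on (possibly open) terms such that for all $s$ (there are no clauses for $\bot$ or variables): Values: $\mathbf 0\Downarrow_{s+1}0$; $a\Downarrow_s n\Rightarrow\mathbf S a\Downarrow_{s+1}n+1$; $a\Downarrow_s m$, $b\Downarrow_s n\Rightarrow(a=b)\Downarrow_{s+1}\mathsf{tt}$ if $m=n$ and $\mathsf{ff}$ otherwise; $a\Downarrow_s\mathsf{ff}\Rightarrow\neg a\Downarrow_{s+1}\mathsf{tt}$; $a\Downarrow_s\mathsf{tt}\Rightarrow\neg a\Downarrow_{s+1}\mathsf{ff}$; $a\Downarrow_s\mathsf{tt}$ or $b\Downarrow_s\mathsf{tt}\Rightarrow(a\lor b)\Downarrow_{s+1}\mathsf{tt}$; $a\Downarrow_s\mathsf{ff}$ and $b\Downarrow_s\mathsf{ff}\Rightarrow(a\lor b)\Downarrow_{s+1}\mathsf{ff}$; $t\Downarrow^{\mathrm{hd}}_s\lambda b$, $b[u]\Downarrow_s r\Rightarrow t\cdot u\Downarrow_{s+1}r$; $t\Downarrow^{\mathrm{hd}}_s\mathcal R\,g\,h$, $m\Downarrow_s 0$, $g\Downarrow_s r\Rightarrow t\cdot m\Downarrow_{s+1}r$; $t\Downarrow^{\mathrm{hd}}_s\mathcal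 R\,g\,h$, $m\Downarrow_s k+1$, $h\cdot\underline k\cdot(\mathcal R\cdot g\cdot h\cdot\underline k)\Downarrow_s r\Rightarrow t\cdot m\Downarrow_{s+1}r$. Quantifier: if $t\Downarrow^{\mathrm{hd}}_s\mathcal A$ and $\ulcorner P\urcorner\le s$, then $P\rhd(\{v_0\,\mathsf N\}\vdash\uparrow u\cdot v_0)\Rightarrow t\cdot u\Downarrow_{s+1}\mathsf{tt}$, and $P\rhd(\emptyset\vdash\neg(u\cdot\underline i))$ for some $i\in\mathbb N$ $\Rightarrow t\cdot u\Downarrow_{s+1}\mathsf{ff}$. Heads: $\lambda b\Downarrow^{\mathrm{hd}}_{s+1}\lambda b$; $\mathcal R\Downarrow^{\mathrm{hd}}_{s+1}\mathcal R$; $\mathcal A\Downarrow^{\mathrm{hd}}_{s+1}\mathcal A$; $t\Downarrow^{\mathrm{hd}}_s\mathcal R\Rightarrow t\cdot g\Downarrow^{\mathrm{hd}}_{s+1}\mathcal R\,g$; $t\Downarrow^{\mathrm{hd}}_s\mathcal R\,g\Rightarrow t\cdot h\Downarrow^{\mathrm{hd}}_{s+1}\mathcal R\,g\,h$; and the three clauses for $t\cdot u$, $t\cdot m$ above (heads $\lambda b$ and $\mathcal R\,g\,h$) with the last premise and the conclusion replaced by head evaluation to the same $w$. *)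

theory Defs
  imports Main "HOL-Library.FSet"
begin

text \<open>
  Raw terms: \<open>Op c k ts\<close> is a node with operator code \<open>c\<close> that binds the \<open>k\<close> lowest de Bruijn
  indices in each of the arguments \<open>ts\<close>.  Operator codes are arbitrary natural numbers, of which
  RGA uses the ten codes 0 to 9; all other nodes are raw but never well-formed.
\<close>

datatype tm = Var nat | Op nat nat "tm list"

abbreviation Bot :: tm where "Bot \<equiv> Op 0 0 []"
abbreviation Zero :: tm where "Zero \<equiv> Op (Suc 0) 0 []"
abbreviation Rec :: tm where "Rec \<equiv> Op 2 0 []"
abbreviation Forall :: tm where "Forall \<equiv> Op 3 0 []"
abbreviation Sc :: "tm \<Rightarrow> tm" where "Sc t \<equiv> Op 4 0 [t]"
abbreviation Neg :: "tm \<Rightarrow> tm" where "Neg t \<equiv> Op 5 0 [t]"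
abbreviation Lam :: "tm \<Rightarrow> tm" where "Lam b \<equiv> Op 6 (Suc 0) [b]"
abbreviation Eq :: "tm \<Rightarrow> tm \<Rightarrow> tm" (infix "\<doteq>" 60) where "t \<doteq> u \<equiv> Op 7 0 [t, u]"
abbreviation Or :: "tm \<Rightarrow> tm \<Rightarrow> tm" (infixr "\<^bold>\<or>" 55) where "t \<^bold>\<or> u \<equiv> Op 8 0 [t, u]"
abbreviation App :: "tm \<Rightarrow> tm \<Rightarrow> tm" (infixl "\<cdot>" 75) where "t \<cdot> u \<equiv> Op 9 0 [t, u]"

abbreviation Neq :: "tm \<Rightarrow> tm \<Rightarrow> tm" where "Neq t u \<equiv> Neg (t \<doteq> u)"
abbreviation IsN :: "tm \<Rightarrow> tm" where "IsN t \<equiv> t \<doteq> t"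
abbreviation IsB :: "tm \<Rightarrow> tm" where "IsB t \<equiv> t \<^bold>\<or> Neg t"
abbreviation And :: "tm \<Rightarrow> tm \<Rightarrow> tm" where "And t u \<equiv> Neg (Neg t \<^bold>\<or> Neg u)"

primrec num :: "nat \<Rightarrow> tm" where
  "num 0 = Zero"
| "num (Suc n) = Sc (num n)"

text \<open>Triples of operator code, binder count and arity.\<close>

definition signature :: "(nat \<times> nat \<times> nat) set" where
  "signature = {(0, 0, 0), (1, 0, 0), (2, 0, 0), (3, 0, 0), (4, 0, 1), (5, 0, 1), (6, 1, 1),
                (7, 0, 2), (8, 0, 2), (9, 0, 2)}"

fun wf_tm :: "tm \<Rightarrow> bool" where
  "wf_tm (Var i) = True"
| "wf_tm (Op c k ts) = ((c, k, length ts) \<in> signature \<and> (\<forall>t \<in> set ts. wf_tm t))"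

fun fv :: "tm \<Rightarrow> nat set" where
  "fv (Var i) = {i}"
| "fv (Op c k ts) = {i. \<exists>t \<in> set ts. i + k \<in> fv t}"

text \<open>\<open>lift d n t\<close> increases by \<open>d\<close> all free indices of \<open>t\<close> that are at least \<open>n\<close>.\<close>

fun lift :: "nat \<Rightarrow> nat \<Rightarrow> tm \<Rightarrow> tm" where
  "lift d n (Var i) = Var (if i < n then i else i + d)"
| "lift d n (Op c k ts) = Op c k (map (lift d (n + k)) ts)"

abbreviation up :: "tm \<Rightarrow> tm" where "up \<equiv> lift (Suc 0) 0"

text \<open>
  \<open>subst i s t\<close> replaces the free variable \<open>i\<close> by \<open>s\<close> and leaves the other free variables alone;
  \<open>inst i s t\<close> moreover removes the index \<open>i\<close>, so that \<open>inst 0 t b\<close> is the beta instance of \<open>b\<close>.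
\<close>

fun subst :: "nat \<Rightarrow> tm \<Rightarrow> tm \<Rightarrow> tm" where
  "subst i s (Var j) = (if j = i then s else Var j)"
| "subst i s (Op c k ts) = Op c k (map (subst (i + k) (lift k 0 s)) ts)"

fun inst :: "nat \<Rightarrow> tm \<Rightarrow> tm \<Rightarrow> tm" where
  "inst i s (Var j) = (if j < i then Var j else if j = i then s else Var (j - 1))"
| "inst i s (Op c k ts) = Op c k (map (inst (i + k) (lift k 0 s)) ts)"

inductive step :: "tm \<Rightarrow> tm \<Rightarrow> bool" (infix "\<rhd>" 50) where
  step_beta: "wf_tm t \<Longrightarrow> Lam b \<cdot> t \<rhd> inst 0 t b"
| step_rec0: "wf_tm h \<Longrightarrow> Rec \<cdot> g \<cdot> h \<cdot> Zero \<rhd> g"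
| step_recS: "wf_tm g \<Longrightarrow> Rec \<cdot> g \<cdot> h \<cdot> Sc (num n) \<rhd> h \<cdot> num n \<cdot> (Rec \<cdot> g \<cdot> h \<cdot> num n)"
| step_app: "t \<rhd> t' \<Longrightarrow> t \<cdot> u \<rhd> t' \<cdot> u"

type_synonym jdg = "tm fset \<times> tm"

text \<open>
  \<open>follows E J\<close>: the judgment \<open>J\<close> follows by one rule application from premises in \<open>E\<close>.
  The rule allowing passage between \<open>IsN a\<close> and \<open>a \<doteq> a\<close> appears only once, since the two sides
  are the same term.
\<close>

inductive follows :: "jdg set \<Rightarrow> jdg \<Rightarrow> bool" for E :: "jdg set" where
  hyp: "wf_tm c \<Longrightarrow> follows E (finsert c \<Gamma>, c)"
| weaken: "(\<Gamma>, c) \<in> E \<Longrightarrow> follows E (finsert a \<Gamma>, c)"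
| cut: "(\<Gamma>, a) \<in> E \<Longrightarrow> (finsert a \<Gamma>, c) \<in> E \<Longrightarrow> follows E (\<Gamma>, c)"
| substitution: "(\<Gamma>, c) \<in> E \<Longrightarrow> (\<forall>g. g |\<in>| \<Gamma> \<longrightarrow> wf_tm g) \<Longrightarrow> wf_tm c \<Longrightarrow> wf_tm s \<Longrightarrow>
    follows E (subst v s |`| \<Gamma>, subst v s c)"

| true_I: "(\<Gamma>, a) \<in> E \<Longrightarrow> follows E (\<Gamma>, a \<doteq> num (Suc 0))"
| true_E: "(\<Gamma>, a \<doteq> num (Suc 0)) \<in> E \<Longrightarrow> follows E (\<Gamma>, a)"
| false_I: "(\<Gamma>, Neg a) \<in> E \<Longrightarrow> follows E (\<Gamma>, a \<doteq> num 0)"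
| false_E: "(\<Gamma>, a \<doteq> num 0) \<in> E \<Longrightarrow> follows E (\<Gamma>, Neg a)"

| neg_E: "(\<Gamma>, Neg a) \<in> E \<Longrightarrow> (\<Gamma>, a) \<in> E \<Longrightarrow> wf_tm c \<Longrightarrow> follows E (\<Gamma>, c)"
| dneg_I: "(\<Gamma>, a) \<in> E \<Longrightarrow> follows E (\<Gamma>, Neg (Neg a))"
| dneg_E: "(\<Gamma>, Neg (Neg a)) \<in> E \<Longrightarrow> follows E (\<Gamma>, a)"

| or_I1: "(\<Gamma>, a) \<in> E \<Longrightarrow> wf_tm b \<Longrightarrow> follows E (\<Gamma>, a \<^bold>\<or> b)"
| or_I2: "(\<Gamma>, b) \<in> E \<Longrightarrow> wf_tm a \<Longrightarrow> follows E (\<Gamma>, a \<^bold>\<or> b)"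
| nor_I: "(\<Gamma>, Neg a) \<in> E \<Longrightarrow> (\<Gamma>, Neg b) \<in> E \<Longrightarrow> follows E (\<Gamma>, Neg (a \<^bold>\<or> b))"
| or_E: "(\<Gamma>, a \<^bold>\<or> b) \<in> E \<Longrightarrow> (finsert a \<Gamma>, c) \<in> E \<Longrightarrow> (finsert b \<Gamma>, c) \<in> E \<Longrightarrow>
    follows E (\<Gamma>, c)"
| nor_E1: "(\<Gamma>, Neg (a \<^bold>\<or> b)) \<in> E \<Longrightarrow> follows E (\<Gamma>, Neg a)"
| nor_E2: "(\<Gamma>, Neg (a \<^bold>\<or> b)) \<in> E \<Longrightarrow> follows E (\<Gamma>, Neg b)"

| isN_eq: "(\<Gamma>, IsN a) \<in> E \<Longrightarrow> follows E (\<Gamma>, a \<doteq> a)"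
| eq_sym: "(\<Gamma>, a \<doteq> b) \<in> E \<Longrightarrow> follows E (\<Gamma>, b \<doteq> a)"
| eq_subst: "(\<Gamma>, a \<doteq> b) \<in> E \<Longrightarrow> (\<Gamma>, subst v a p) \<in> E \<Longrightarrow> wf_tm p \<Longrightarrow>
    follows E (\<Gamma>, subst v b p)"
| neq_sym: "(\<Gamma>, Neq a b) \<in> E \<Longrightarrow> follows E (\<Gamma>, Neq b a)"
| eq_B_I: "(\<Gamma>, IsN a) \<in> E \<Longrightarrow> (\<Gamma>, IsN b) \<in> E \<Longrightarrow> follows E (\<Gamma>, IsB (a \<doteq> b))"
| eq_B_E: "(\<Gamma>, IsB (a \<doteq> b)) \<in> E \<Longrightarrow> follows E (\<Gamma>, And (IsN a) (IsN b))"

| zero_N: "follows E (\<Gamma>, IsN Zero)"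
| suc_N_I: "(\<Gamma>, IsN a) \<in> E \<Longrightarrow> follows E (\<Gamma>, IsN (Sc a))"
| suc_N_E: "(\<Gamma>, IsN (Sc a)) \<in> E \<Longrightarrow> follows E (\<Gamma>, IsN a)"
| suc_neq_zero: "(\<Gamma>, IsN a) \<in> E \<Longrightarrow> follows E (\<Gamma>, Neq (Sc a) Zero)"
| suc_neq_I: "(\<Gamma>, Neq a b) \<in> E \<Longrightarrow> follows E (\<Gamma>, Neq (Sc a) (Sc b))"
| suc_neq_E: "(\<Gamma>, Neq (Sc a) (Sc b)) \<in> E \<Longrightarrow> follows E (\<Gamma>, Neq a b)"
| suc_inj: "(\<Gamma>, Sc a \<doteq> Sc b) \<in> E \<Longrightarrow> follows E (\<Gamma>, a \<doteq> b)"
| bot_E: "(\<Gamma>, IsN Bot) \<in> E \<Longrightarrow> wf_tm p \<Longrightarrow> follows E (\<Gamma>, p)"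

| induction: "(\<Gamma>, subst i Zero c) \<in> E \<Longrightarrow>
    (finsert (IsN (Var i)) (finsert c \<Gamma>), subst i (Sc (Var i)) c) \<in> E \<Longrightarrow>
    (\<Gamma>, IsN a) \<in> E \<Longrightarrow> wf_tm c \<Longrightarrow> (\<forall>g. g |\<in>| \<Gamma> \<longrightarrow> i \<notin> fv g) \<Longrightarrow>
    follows E (\<Gamma>, subst i a c)"

| conv_expand: "c \<rhd> c' \<Longrightarrow> (\<Gamma>, c') \<in> E \<Longrightarrow> follows E (\<Gamma>, c)"
| conv_reduce: "c \<rhd> c' \<Longrightarrow> (\<Gamma>, c) \<in> E \<Longrightarrow> follows E (\<Gamma>, c')"
| conv_eq: "c \<rhd> c' \<Longrightarrow> (\<Gamma>, IsN c') \<in> E \<Longrightarrow> follows E (\<Gamma>, c \<doteq> c')"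

| recursor: "(\<Gamma>, IsN m) \<in> E \<Longrightarrow> (\<Gamma>, IsN (h \<cdot> m \<cdot> (Rec \<cdot> g \<cdot> h \<cdot> m))) \<in> E \<Longrightarrow> wf_tm g \<Longrightarrow>
    follows E (\<Gamma>, Rec \<cdot> g \<cdot> h \<cdot> Sc m \<doteq> h \<cdot> m \<cdot> (Rec \<cdot> g \<cdot> h \<cdot> m))"

| all_I: "(finsert (IsN (Var 0)) (up |`| \<Gamma>), up f \<cdot> Var 0) \<in> E \<Longrightarrow> follows E (\<Gamma>, Forall \<cdot> f)"
| all_E: "(\<Gamma>, Forall \<cdot> f) \<in> E \<Longrightarrow> (\<Gamma>, IsN a) \<in> E \<Longrightarrow> follows E (\<Gamma>, f \<cdot> a)"
| nall_I: "(\<Gamma>, Neg (f \<cdot> a)) \<in> E \<Longrightarrow> (\<Gamma>, IsN a) \<in> E \<Longrightarrow> follows E (\<Gamma>, Neg (Forall \<cdot> f))"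
| nall_E: "(\<Gamma>, Neg (Forall \<cdot> f)) \<in> E \<Longrightarrow>
    (finsert (IsN (Var 0)) (finsert (Neg (up f \<cdot> Var 0)) (up |`| \<Gamma>)), up c) \<in> E \<Longrightarrow>
    follows E (\<Gamma>, c)"

definition valid_proof :: "jdg list \<Rightarrow> bool" where
  "valid_proof P \<longleftrightarrow> (\<forall>i < length P. follows (set (take i P)) (P ! i))"

definition proves :: "jdg list \<Rightarrow> jdg \<Rightarrow> bool" where
  "proves P J \<longleftrightarrow> valid_proof P \<and> J \<in> set P"

definition derivable :: "tm fset \<Rightarrow> tm \<Rightarrow> bool" (infix "\<turnstile>" 40) where
  "\<Gamma> \<turnstile> c \<longleftrightarrow> (\<exists>P. proves P (\<Gamma>, c))"

datatype head = HLam tm | HRec | HRec1 tm | HRec2 tm tm | HAll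

abbreviation (input) tt :: nat where "tt \<equiv> Suc 0"
abbreviation (input) ff :: nat where "ff \<equiv> 0"

text \<open>
  \<open>eval code s t r\<close> and \<open>heval code s t w\<close> are value and head evaluation of \<open>t\<close> with step index
  \<open>s\<close>, where \<open>code\<close> is the Goedel coding of proofs used to bound the proof search.
\<close>

inductive eval :: "(jdg list \<Rightarrow> nat) \<Rightarrow> nat \<Rightarrow> tm \<Rightarrow> nat \<Rightarrow> bool"
  and heval :: "(jdg list \<Rightarrow> nat) \<Rightarrow> nat \<Rightarrow> tm \<Rightarrow> head \<Rightarrow> bool"
  for code :: "jdg list \<Rightarrow> nat" where
  ev_zero: "eval code (Suc s) Zero 0"
| ev_suc: "eval code s a n \<Longrightarrow> eval code (Suc s) (Sc a) (Suc n)"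
| ev_eq: "eval code s a m \<Longrightarrow> eval code s b n \<Longrightarrow>
    eval code (Suc s) (a \<doteq> b) (if m = n then tt else ff)"
| ev_neg_ff: "eval code s a ff \<Longrightarrow> eval code (Suc s) (Neg a) tt"
| ev_neg_tt: "eval code s a tt \<Longrightarrow> eval code (Suc s) (Neg a) ff"
| ev_or_tt1: "eval code s a tt \<Longrightarrow> eval code (Suc s) (a \<^bold>\<or> b) tt"
| ev_or_tt2: "eval code s b tt \<Longrightarrow> eval code (Suc s) (a \<^bold>\<or> b) tt"
| ev_or_ff: "eval code s a ff \<Longrightarrow> eval code s b ff \<Longrightarrow> eval code (Suc s) (a \<^bold>\<or> b) ff"
| ev_beta: "heval code s t (HLam b) \<Longrightarrow> eval code s (inst 0 u b) r \<Longrightarrow>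
    eval code (Suc s) (t \<cdot> u) r"
| ev_rec0: "heval code s t (HRec2 g h) \<Longrightarrow> eval code s m 0 \<Longrightarrow> eval code s g r \<Longrightarrow>
    eval code (Suc s) (t \<cdot> m) r"
| ev_recS: "heval code s t (HRec2 g h) \<Longrightarrow> eval code s m (Suc k) \<Longrightarrow>
    eval code s (h \<cdot> num k \<cdot> (Rec \<cdot> g \<cdot> h \<cdot> num k)) r \<Longrightarrow>
    eval code (Suc s) (t \<cdot> m) r"
| ev_all_tt: "heval code s t HAll \<Longrightarrow> code P \<le> s \<Longrightarrow>
    proves P ({|IsN (Var 0)|}, up u \<cdot> Var 0) \<Longrightarrow> eval code (Suc s) (t \<cdot> u) tt"
| ev_all_ff: "heval code s t HAll \<Longrightarrow> code P \<le> s \<Longrightarrow>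
    proves P ({||}, Neg (u \<cdot> num i)) \<Longrightarrow> eval code (Suc s) (t \<cdot> u) ff"
| hd_lam: "heval code (Suc s) (Lam b) (HLam b)"
| hd_rec: "heval code (Suc s) Rec HRec"
| hd_all: "heval code (Suc s) Forall HAll"
| hd_rec1: "heval code s t HRec \<Longrightarrow> heval code (Suc s) (t \<cdot> g) (HRec1 g)"
| hd_rec2: "heval code s t (HRec1 g) \<Longrightarrow> heval code (Suc s) (t \<cdot> h) (HRec2 g h)"
| hd_beta: "heval code s t (HLam b) \<Longrightarrow> heval code s (inst 0 u b) w \<Longrightarrow>
    heval code (Suc s) (t \<cdot> u) w"
| hd_rec0: "heval code s t (HRec2 g h) \<Longrightarrow> eval code s m 0 \<Longrightarrow> heval code s g w \<Longrightarrow>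
    heval code (Suc s) (t \<cdot> m) w"
| hd_recS: "heval code s t (HRec2 g h) \<Longrightarrow> eval code s m (Suc k) \<Longrightarrow>
    heval code s (h \<cdot> num k \<cdot> (Rec \<cdot> g \<cdot> h \<cdot> num k)) w \<Longrightarrow>
    heval code (Suc s) (t \<cdot> m) w"

end

theory Submission
  imports Defs
begin

text \<open>
  Evaluation decides a quantified term \<open>Forall \<cdot> u\<close> by looking for a proof of \<open>up u \<cdot> Var 0\<close> or of some
  \<open>Neg (u \<cdot> num i)\<close>.  A direct soundness argument therefore goes in circles: instantiating a true
  universal formula requires the proof found by the search to be sound, and that proof has no
  relation to the derivation under consideration.

  The circle is broken by a relation \<open>ev\<close> without step index that asks for more in the two quantifier
  clauses: besides the derivation, the instances themselves must evaluate accordingly, all of them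
  to \<open>tt\<close> in the first clause, the \<open>i\<close>-th one to \<open>ff\<close> in the second.  It is an inductive definition
  with infinitely many premises, and all of its premises are positive.  Since an \<open>ev\<close>-derivation
  contains everything that an evaluation needs, \<open>ev t r\<close> implies \<open>eval code s t r\<close> for all large
  \<open>s\<close> (\<open>ev_imp_eval\<close>): although the tree may be infinite, each clause of \<open>eval\<close> uses only finitely
  many of the premises.

  For \<open>ev\<close>, an ordinary soundness proof works (\<open>derivable_sound\<close>): a formula is true when it
  evaluates to \<open>tt\<close>, and truth is preserved by every rule, under all substitutions of well-formed
  (not necessarily evaluating) terms for the free variables.  Elimination of quantifiers just reads
  off the additional premise.  Introduction has to produce the derivation demanded by the clause,
  and this is where the context matters.  The given derivation has open hypotheses \<open>\<Gamma>\<close> and free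
  variables; it is instantiated by a simultaneous substitution (\<open>derivable_subs\<close>), after which the
  hypotheses are cut away, because whatever evaluates to \<open>tt\<close> is derivable (\<open>ev_derivable\<close>).  The
  rules that replace equals by equals, including induction, need that \<open>ev\<close> does not distinguish
  two terms with the same value (\<open>ev_subst_cong\<close>).  The result is the case of the formula
  \<open>IsN t\<close>, the empty context and the identity substitution.
\<close>

section \<open>Simultaneous substitution\<close>

text \<open>
  The substitution induced by \<open>\<sigma>\<close> beneath \<open>k\<close> further binders.
\<close>

definition under :: "nat \<Rightarrow> (nat \<Rightarrow> tm) \<Rightarrow> nat \<Rightarrow> tm" where
  "under k \<sigma> i = (if i < k then Var i else lift k 0 (\<sigma> (i - k)))"

fun subs :: "(nat \<Rightarrow> tm) \<Rightarrow> tm \<Rightarrow> tm" where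
  "subs \<sigma> (Var i) = \<sigma> i"
| "subs \<sigma> (Op c k ts) = Op c k (map (subs (under k \<sigma>)) ts)"

lemma lift_0 [simp]: "lift 0 n t = t"
  by (induction t arbitrary: n) (auto intro: map_idI)

lemma under_0 [simp]: "under 0 \<sigma> = \<sigma>"
  by (rule ext) (simp add: under_def)

text \<open>
  The cutoff \<open>m\<close> counts the binders passed by the induction.
\<close>

lemma lift_lift: "lift d (n + k + m) (lift k m t) = lift k m (lift d (n + m) t)"
proof (induction t arbitrary: m)
  case (Op c j ts)
  have "lift d (n + k + m + j) (lift k (m + j) x) = lift k (m + j) (lift d (n + m + j) x)"
    if "x \<in> set ts" for x
    using Op[OF that, of "m + j"] by (simp add: add.assoc)
  then show ?case by simp
qed simp

text \<open>
  The operations \<open>lift\<close>, \<open>subst\<close> and \<open>inst\<close> are all instances of simultaneous substitution, so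
  that the laws about composing them reduce to \<open>subs_subs\<close> and a comparison of functions on
  indices.  The composition law itself needs the two cases in which one factor is a lifting first.
\<close>

lemma subs_lift: "subs \<sigma> (lift d n t) = subs (\<lambda>i. if i < n then \<sigma> i else \<sigma> (i + d)) t"
proof (induction t arbitrary: n \<sigma>)
  case (Op c k ts)
  have "under k (\<lambda>i. if i < n then \<sigma> i else \<sigma> (i + d))
      = (\<lambda>i. if i < n + k then under k \<sigma> i else under k \<sigma> (i + d))"
    by (auto simp: under_def fun_eq_iff)
  then show ?case using Op by simp
qed simp

lemma lift_subs: "lift d n (subs \<sigma> t) = subs (\<lambda>i. lift d n (\<sigma> i)) t"
proof (induction t arbitrary: n \<sigma>)
  case (Op c k ts)
  have "under k (\<lambda>i. lift d n (\<sigma> i)) = (\<lambda>i. lift d (n + k) (under k \<sigma> i))"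
    using lift_lift[of d n k 0] by (auto simp: under_def fun_eq_iff)
  then show ?case using Op by simp
qed simp

lemma subs_under_lift: "subs (under k \<sigma>) (lift k 0 t) = lift k 0 (subs \<sigma> t)"
  by (simp add: subs_lift lift_subs under_def)

lemma subs_subs: "subs \<tau> (subs \<sigma> t) = subs (\<lambda>i. subs \<tau> (\<sigma> i)) t"
proof (induction t arbitrary: \<sigma> \<tau>)
  case (Op c k ts)
  have "under k (\<lambda>i. subs \<tau> (\<sigma> i)) = (\<lambda>i. subs (under k \<tau>) (under k \<sigma> i))"
    by (auto simp: under_def[of k \<sigma>] under_def[of k "\<lambda>i. subs \<tau> (\<sigma> i)"] subs_under_lift
        fun_eq_iff) (simp add: under_def)
  then show ?case using Op by simp
qed simp

lemma under_Var [simp]: "under k Var = Var"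
  by (auto simp: under_def fun_eq_iff)

lemma subs_Var [simp]: "subs Var t = t"
  by (induction t) (auto intro: map_idI)

lemma subs_cong: "(\<And>i. i \<in> fv t \<Longrightarrow> \<sigma> i = \<tau> i) \<Longrightarrow> subs \<sigma> t = subs \<tau> t"
proof (induction t arbitrary: \<sigma> \<tau>)
  case (Op c k ts)
  have "subs (under k \<sigma>) x = subs (under k \<tau>) x" if x: "x \<in> set ts" for x
  proof (rule Op.IH[OF x])
    fix i assume i: "i \<in> fv x"
    show "under k \<sigma> i = under k \<tau> i"
    proof (cases "i < k")
      case False
      then have "i - k \<in> fv (Op c k ts)" using i x by auto
      then show ?thesis using Op.prems[of "i - k"] False by (simp add: under_def)
    qed (simp add: under_def)
  qed
  then show ?case by simp
qed simp

lemma subst_subs: "subst i s t = subs (Var(i := s)) t"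
proof (induction t arbitrary: i s)
  case (Op c k ts)
  have "under k (Var(i := s)) = Var(i + k := lift k 0 s)"
    by (auto simp: under_def fun_eq_iff)
  then show ?case using Op by (simp add: fun_upd_def)
qed simp

lemma inst_subs: "inst i s t = subs (\<lambda>j. if j < i then Var j else if j = i then s else Var (j - 1)) t"
proof (induction t arbitrary: i s)
  case (Op c k ts)
  have "under k (\<lambda>j. if j < i then Var j else if j = i then s else Var (j - 1))
     = (\<lambda>j. if j < i + k then Var j else if j = i + k then lift k 0 s else Var (j - 1))"
    by (auto simp: under_def fun_eq_iff)
  then show ?case using Op by simp
qed simp

lemma inst_0_subs: "inst 0 s t = subs (case_nat s Var) t"
  unfolding inst_subs by (rule arg_cong[where f = "\<lambda>\<sigma>. subs \<sigma> t"]) (auto split: nat.split)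

lemma subs_case_nat_up [simp]: "subs (case_nat s \<sigma>) (up t) = subs \<sigma> t"
  by (simp add: subs_lift)

lemma subs_under_up: "subs (under (Suc 0) \<sigma>) (up t) = up (subs \<sigma> t)"
  by (rule subs_under_lift)

lemma subs_inst_0: "subs \<sigma> (inst 0 u b) = inst 0 (subs \<sigma> u) (subs (under (Suc 0) \<sigma>) b)"
proof -
  have "(\<lambda>i. subs \<sigma> (case_nat u Var i))
      = (\<lambda>i. subs (case_nat (subs \<sigma> u) Var) (under (Suc 0) \<sigma> i))"
    by (auto simp: under_def fun_eq_iff split: nat.split)
  then show ?thesis by (simp add: inst_0_subs subs_subs)
qed

lemma subst_inst_0: "subst v a (inst 0 u b) = inst 0 (subst v a u) (subst (Suc v) (up a) b)"
proof -
  have "under (Suc 0) (Var(v := a)) = Var(Suc v := up a)"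
    by (auto simp: under_def fun_eq_iff)
  then show ?thesis by (simp add: subst_subs subs_inst_0)
qed

lemma up_subst: "up (subst v a p) = subst (Suc v) (up a) (up p)"
  by (auto simp: subst_subs lift_subs subs_lift intro!: subs_cong)

lemma subs_num [simp]: "subs \<sigma> (num n) = num n"
  by (induction n) auto

lemma subst_num [simp]: "subst i s (num n) = num n"
  by (simp add: subst_subs)

lemma up_num [simp]: "up (num n) = num n"
  by (induction n) auto

lemma wf_lift [simp]: "wf_tm (lift d n t) \<longleftrightarrow> wf_tm t"
  by (induction t arbitrary: n) auto

lemma wf_subs: "(\<And>i. wf_tm (\<sigma> i)) \<Longrightarrow> wf_tm (subs \<sigma> t) \<longleftrightarrow> wf_tm t"
proof (induction t arbitrary: \<sigma>)
  case (Op c k ts)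
  have "wf_tm (under k \<sigma> i)" for i using Op.prems by (simp add: under_def)
  then show ?case using Op.IH by auto
qed simp

lemma wf_subst: "wf_tm s \<Longrightarrow> wf_tm (subst i s t) \<longleftrightarrow> wf_tm t"
  by (simp add: subst_subs wf_subs)

lemma wf_inst_0: "wf_tm s \<Longrightarrow> wf_tm (inst 0 s t) \<longleftrightarrow> wf_tm t"
  by (auto simp: inst_0_subs intro!: wf_subs split: nat.split)

lemma wf_num [simp]: "wf_tm (num n)"
  by (induction n) (auto simp: signature_def)

lemma wf_node [simp]:
  "wf_tm Bot" "wf_tm Zero" "wf_tm Rec" "wf_tm Forall"
  "wf_tm (Sc a) \<longleftrightarrow> wf_tm a" "wf_tm (Neg a) \<longleftrightarrow> wf_tm a" "wf_tm (Lam a) \<longleftrightarrow> wf_tm a"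
  "wf_tm (a \<doteq> b) \<longleftrightarrow> wf_tm a \<and> wf_tm b" "wf_tm (a \<^bold>\<or> b) \<longleftrightarrow> wf_tm a \<and> wf_tm b"
  "wf_tm (a \<cdot> b) \<longleftrightarrow> wf_tm a \<and> wf_tm b"
  by (auto simp: signature_def)

declare wf_tm.simps(2) [simp del]

lemma finite_fv: "finite (fv t)"
proof (induction t)
  case (Op c k ts)
  have "fv (Op c k ts) \<subseteq> (\<Union>t\<in>set ts. (\<lambda>i. i - k) ` fv t)"
  proof
    fix i assume "i \<in> fv (Op c k ts)"
    then obtain t where "t \<in> set ts" "i + k \<in> fv t" by auto
    then show "i \<in> (\<Union>t\<in>set ts. (\<lambda>i. i - k) ` fv t)" by (force intro!: bexI image_eqI)
  qed
  then show ?case using Op by (meson finite_UN finite_imageI finite_set finite_subset)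
qed simp

lemma subst_fresh: "v \<notin> fv t \<Longrightarrow> subst v s t = t"
  by (metis fun_upd_other subs_Var subs_cong subst_subs)

lemma fresh: obtains v where "v \<notin> fv t"
  using finite_fv by (meson ex_new_if_finite infinite_UNIV_nat)

text \<open>
  Head steps carry side conditions of well-formedness and inspect numerals.  The former are
  stable under well-formed substitutions, and numerals are closed.
\<close>

lemma step_subs: "c \<rhd> c' \<Longrightarrow> (\<And>i. wf_tm (\<sigma> i)) \<Longrightarrow> subs \<sigma> c \<rhd> subs \<sigma> c'"
proof (induction rule: step.induct)
  case (step_beta t b)
  then show ?case by (auto simp: subs_inst_0 wf_subs intro: step.intros)
next
  case (step_rec0 h g)
  then show ?case by (auto simp: wf_subs intro: step.intros)
next
  case (step_recS g h n)
  then show ?case by (auto simp: wf_subs intro: step.intros)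
next
  case (step_app t t' u)
  then show ?case by (auto intro: step.intros)
qed

lemma step_wf: "c \<rhd> c' \<Longrightarrow> wf_tm c \<longleftrightarrow> wf_tm c'"
  by (induction rule: step.induct) (auto simp: wf_inst_0)


section \<open>Derivability\<close>

lemma follows_mono: "follows E J \<Longrightarrow> E \<subseteq> F \<Longrightarrow> follows F J"
  by (erule follows.cases; hypsubst)
    (rule follows.intros; (assumption | rule subsetD, assumption, assumption))+

text \<open>
  Each rule has at most three premises.  This is what allows finitely many proofs to be joined in
  \<open>derivable_follows\<close>; it is stated as an elimination rule with one case per number of premises.
\<close>

lemma follows_compact:
  assumes zero: "follows {} J \<Longrightarrow> Q"
    and one: "\<And>x. x \<in> E \<Longrightarrow> follows {x} J \<Longrightarrow> Q"
    and two: "\<And>x y. x \<in> E \<Longrightarrow> y \<in> E \<Longrightarrow> follows {x, y} J \<Longrightarrow> Q"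
    and three: "\<And>x y z. x \<in> E \<Longrightarrow> y \<in> E \<Longrightarrow> z \<in> E \<Longrightarrow> follows {x, y, z} J \<Longrightarrow> Q"
    and "follows E J"
  shows Q
proof -
  note m = insertI1 insertI2[OF insertI1] insertI2[OF insertI2[OF insertI1]]
  from \<open>follows E J\<close> show Q
    by (rule follows.cases)
      (rule zero, erule ssubst, rule follows.intros; assumption
      | rule one, assumption, erule ssubst, rule follows.intros; (assumption | rule m)
      | rule two, assumption, assumption, erule ssubst, rule follows.intros; (assumption | rule m)
      | rule three, assumption, assumption, assumption, erule ssubst, rule follows.intros;
          (assumption | rule m))+
qed

lemma valid_proof_append:
  assumes "valid_proof P" "valid_proof Q"
  shows "valid_proof (P @ Q)"
  unfolding valid_proof_def
proof (intro allI impI)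
  fix i assume i: "i < length (P @ Q)"
  show "follows (set (take i (P @ Q))) ((P @ Q) ! i)"
  proof (cases "i < length P")
    case True
    then show ?thesis using assms(1) by (simp add: valid_proof_def nth_append)
  next
    case False
    then have "follows (set (take (i - length P) Q)) (Q ! (i - length P))"
      using assms(2) i by (simp add: valid_proof_def)
    then show ?thesis using False by (auto simp: nth_append intro: follows_mono)
  qed
qed

lemma derivable_if_follows_proof:
  assumes "valid_proof P" "follows (set P) (\<Gamma>, c)"
  shows "\<Gamma> \<turnstile> c"
proof -
  have "valid_proof (P @ [(\<Gamma>, c)])"
    using assms by (auto simp: valid_proof_def nth_append less_Suc_eq)
  then show ?thesis unfolding derivable_def proves_def by force
qed

text \<open>
  Derivability is closed under the rules: proofs of the premises can be concatenated, since
  following from an earlier entry is monotone in the set of earlier entries.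
\<close>

lemma derivable_follows:
  assumes "follows {(\<Gamma>, c). \<Gamma> \<turnstile> c} (\<Delta>, d)"
  shows "\<Delta> \<turnstile> d"
proof -
  have ex: "\<exists>P. valid_proof P \<and> x \<in> set P" if "x \<in> {(\<Gamma>, c). \<Gamma> \<turnstile> c}" for x
    using that by (auto simp: derivable_def proves_def)
  have join: "\<exists>P. valid_proof P \<and> A \<subseteq> set P"
    if "finite A" "A \<subseteq> {(\<Gamma>, c). \<Gamma> \<turnstile> c}" for A
    using that
  proof (induction A rule: finite_induct)
    case empty
    have "valid_proof []" by (simp add: valid_proof_def)
    then show ?case by blast
  next
    case (insert x A)
    from insert obtain P where "valid_proof P" "A \<subseteq> set P" by auto
    moreover from insert.prems obtain Q where "valid_proof Q" "x \<in> set Q"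
      using ex[of x] by blast
    ultimately have "valid_proof (P @ Q)" "insert x A \<subseteq> set (P @ Q)"
      by (auto intro: valid_proof_append)
    then show ?case by blast
  qed
  have "\<Delta> \<turnstile> d" if "finite A" "A \<subseteq> {(\<Gamma>, c). \<Gamma> \<turnstile> c}" "follows A (\<Delta>, d)" for A
    using join[OF that(1,2)] derivable_if_follows_proof follows_mono[OF that(3)] by blast
  note der = this
  show ?thesis
    by (rule follows_compact[OF _ _ _ _ assms]; rule der; (assumption | simp))
qed

text \<open>
  Entries of a proof follow from earlier entries, which are derivable themselves; so rule
  induction is course-of-values induction on the position in the proof.
\<close>

lemma derivable_induct [consumes 1, case_names follows]:
  assumes "\<Gamma> \<turnstile> c"
    and step: "\<And>\<Gamma> c. follows {(\<Gamma>, c). \<Gamma> \<turnstile> c \<and> Q \<Gamma> c} (\<Gamma>, c) \<Longrightarrow> Q \<Gamma> c"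
  shows "Q \<Gamma> c"
proof -
  obtain P where P: "valid_proof P" "(\<Gamma>, c) \<in> set P"
    using assms(1) by (auto simp: derivable_def proves_def)
  have "case P ! i of (\<Gamma>, c) \<Rightarrow> Q \<Gamma> c" if "i < length P" for i
    using that
  proof (induction i rule: less_induct)
    case (less i)
    have "set (take i P) \<subseteq> {(\<Gamma>, c). \<Gamma> \<turnstile> c \<and> Q \<Gamma> c}"
    proof
      fix J assume "J \<in> set (take i P)"
      then obtain j where j: "j < i" "J = P ! j" "j < length P"
        by (auto simp: in_set_conv_nth)
      moreover have "J \<in> set P" using j by simp
      then have "case J of (\<Gamma>, c) \<Rightarrow> \<Gamma> \<turnstile> c"
        using P(1) by (auto simp: derivable_def proves_def)
      ultimately show "J \<in> {(\<Gamma>, c). \<Gamma> \<turnstile> c \<and> Q \<Gamma> c}"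
        using less.IH[of j] by auto
    qed
    moreover have "follows (set (take i P)) (P ! i)"
      using P(1) less.prems by (simp add: valid_proof_def)
    ultimately have "follows {(\<Gamma>, c). \<Gamma> \<turnstile> c \<and> Q \<Gamma> c} (P ! i)"
      by (rule follows_mono[rotated])
    then show ?case by (cases "P ! i") (simp add: step)
  qed
  moreover obtain i where "i < length P" "P ! i = (\<Gamma>, c)"
    using P(2) by (auto simp: in_set_conv_nth)
  ultimately show ?thesis by fastforce
qed

lemmas derivable_weaken = weaken[THEN derivable_follows, unfolded mem_Collect_eq prod.case]
lemmas derivable_cut = cut[THEN derivable_follows, unfolded mem_Collect_eq prod.case]
lemmas derivable_substitution = substitution[THEN derivable_follows, unfolded mem_Collect_eq prod.case]
lemmas derivable_true_I = true_I[THEN derivable_follows, unfolded mem_Collect_eq prod.case]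
lemmas derivable_true_E = true_E[THEN derivable_follows, unfolded mem_Collect_eq prod.case]
lemmas derivable_false_I = false_I[THEN derivable_follows, unfolded mem_Collect_eq prod.case]
lemmas derivable_false_E = false_E[THEN derivable_follows, unfolded mem_Collect_eq prod.case]
lemmas derivable_dneg_I = dneg_I[THEN derivable_follows, unfolded mem_Collect_eq prod.case]
lemmas derivable_or_I1 = or_I1[THEN derivable_follows, unfolded mem_Collect_eq prod.case]
lemmas derivable_or_I2 = or_I2[THEN derivable_follows, unfolded mem_Collect_eq prod.case]
lemmas derivable_nor_I = nor_I[THEN derivable_follows, unfolded mem_Collect_eq prod.case]
lemmas derivable_eq_sym = eq_sym[THEN derivable_follows, unfolded mem_Collect_eq prod.case]
lemmas derivable_neq_sym = neq_sym[THEN derivable_follows, unfolded mem_Collect_eq prod.case]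
lemmas derivable_eq_subst = eq_subst[THEN derivable_follows, unfolded mem_Collect_eq prod.case]
lemmas derivable_zero_N = zero_N[THEN derivable_follows]
lemmas derivable_suc_N = suc_N_I[THEN derivable_follows, unfolded mem_Collect_eq prod.case]
lemmas derivable_suc_neq_zero = suc_neq_zero[THEN derivable_follows, unfolded mem_Collect_eq prod.case]
lemmas derivable_suc_neq_I = suc_neq_I[THEN derivable_follows, unfolded mem_Collect_eq prod.case]
lemmas derivable_conv_eq = conv_eq[THEN derivable_follows, unfolded mem_Collect_eq prod.case]
lemmas derivable_all_I = all_I[THEN derivable_follows, unfolded mem_Collect_eq prod.case]
lemmas derivable_nall_I = nall_I[THEN derivable_follows, unfolded mem_Collect_eq prod.case]

text \<open>
  Weakening may add ill-formed hypotheses, but the only rule that turns a hypothesis into a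
  conclusion checks that it is well-formed.
\<close>

lemma derivable_wf: "\<Gamma> \<turnstile> c \<Longrightarrow> wf_tm c"
proof (induction rule: derivable_induct)
  case (follows \<Gamma> c)
  then show ?case
    by (cases rule: follows.cases) (auto simp: wf_subst step_wf)
qed

text \<open>
  The substitution rule replaces one variable at a time, and the terms substituted may contain
  variables that are still to be replaced.  Therefore the relevant variables \<open>0, \<dots>, N - 1\<close> are
  first moved to \<open>M, \<dots>, M + N - 1\<close>, beyond all variables occurring in the judgment or in the terms
  \<open>\<sigma> i\<close>, and then replaced one by one by their final values.
\<close>

lemma derivable_subs:
  assumes der: "\<Gamma> \<turnstile> c" and wf_\<Gamma>: "\<And>g. g |\<in>| \<Gamma> \<Longrightarrow> wf_tm g" and wf_\<sigma>: "\<And>i. wf_tm (\<sigma> i)"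
  shows "subs \<sigma> |`| \<Gamma> \<turnstile> subs \<sigma> c"
proof -
  have extend: "(\<lambda>t. subst v s (subs \<rho> t)) |`| \<Gamma> \<turnstile> subst v s (subs \<rho> c)"
    if "subs \<rho> |`| \<Gamma> \<turnstile> subs \<rho> c" "\<And>i. wf_tm (\<rho> i)" "wf_tm s" for \<rho> v s
  proof -
    have "subst v s |`| subs \<rho> |`| \<Gamma> \<turnstile> subst v s (subs \<rho> c)"
      using that wf_\<Gamma> by (intro derivable_substitution) (auto simp: wf_subs derivable_wf[OF der])
    then show ?thesis by (simp add: fset.map_comp comp_def)
  qed
  have "finite (\<Union>t\<in>insert c (fset \<Gamma>). fv t)" by (simp add: finite_fv)
  then obtain N where N: "\<And>t i. t \<in> insert c (fset \<Gamma>) \<Longrightarrow> i \<in> fv t \<Longrightarrow> i < N"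
    unfolding finite_nat_set_iff_bounded by blast
  have "finite (\<Union>i<N. fv (\<sigma> i))" by (simp add: finite_fv)
  then obtain K where K: "\<And>i j. i < N \<Longrightarrow> j \<in> fv (\<sigma> i) \<Longrightarrow> j < K"
    unfolding finite_nat_set_iff_bounded by blast
  define M where "M = max N K"
  have M: "N \<le> M" "\<And>i j. i < N \<Longrightarrow> j \<in> fv (\<sigma> i) \<Longrightarrow> j < M"
    using K by (auto simp: M_def less_max_iff_disj)
  \<comment> \<open>\<open>\<rho> k\<close> has moved the first \<open>k\<close> variables away, \<open>\<tau> k\<close> has given \<open>k\<close> of them their final value;
    \<open>\<rho> N\<close> and \<open>\<tau> 0\<close> agree on the variables that occur.\<close>
  define \<rho> where "\<rho> k i = (if i < k then Var (i + M) else Var i)" for k i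
  define \<tau> where "\<tau> k i = (if i < k then \<sigma> i else Var (i + M))" for k i
  have away: "subs (\<rho> k) |`| \<Gamma> \<turnstile> subs (\<rho> k) c" if "k \<le> N" for k
    using that
  proof (induction k)
    case 0
    have "\<rho> 0 = Var" by (auto simp: \<rho>_def)
    then show ?case using der by (simp add: fset.map_ident)
  next
    case (Suc k)
    have "subst k (Var (k + M)) (subs (\<rho> k) t) = subs (\<rho> (Suc k)) t" for t
      unfolding subst_subs subs_subs using Suc.prems M(1)
      by (intro subs_cong) (auto simp: \<rho>_def)
    moreover have "wf_tm (\<rho> k i)" for i by (simp add: \<rho>_def)
    ultimately show ?case using extend[of "\<rho> k" "Var (k + M)" k] Suc by simp
  qed
  have same: "subs \<theta> |`| \<Gamma> = subs \<eta> |`| \<Gamma>" "subs \<theta> c = subs \<eta> c"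
    if "\<And>i. i < N \<Longrightarrow> \<theta> i = \<eta> i" for \<theta> \<eta>
    using N that by (force intro!: fset.map_cong subs_cong)+
  have return: "subs (\<tau> k) |`| \<Gamma> \<turnstile> subs (\<tau> k) c" if "k \<le> N" for k
    using that
  proof (induction k)
    case 0
    have "\<rho> N i = \<tau> 0 i" if "i < N" for i using that by (simp add: \<rho>_def \<tau>_def)
    then show ?case using away[of N] same[of "\<rho> N" "\<tau> 0"] by simp
  next
    case (Suc k)
    have *: "subst (k + M) (\<sigma> k) (\<tau> k i) = \<tau> (Suc k) i" if "i < N" for i
    proof (cases "i < k")
      case True
      then have "k + M \<notin> fv (\<sigma> i)" using M(2)[of i "k + M"] that by auto
      then show ?thesis using True by (simp add: \<tau>_def subst_fresh)
    qed (auto simp: \<tau>_def less_Suc_eq)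
    have "(\<lambda>t. subst (k + M) (\<sigma> k) (subs (\<tau> k) t)) = subs (\<lambda>i. subst (k + M) (\<sigma> k) (\<tau> k i))"
      by (simp add: subst_subs subs_subs)
    moreover have "wf_tm (\<tau> k i)" for i by (simp add: \<tau>_def wf_\<sigma>)
    ultimately show ?case
      using extend[of "\<tau> k" "\<sigma> k" "k + M"] Suc wf_\<sigma>
        same[of "\<lambda>i. subst (k + M) (\<sigma> k) (\<tau> k i)" "\<tau> (Suc k)", OF *]
      by (simp add: fun_eq_iff)
  qed
  have "\<tau> N i = \<sigma> i" if "i < N" for i using that by (simp add: \<tau>_def)
  then show ?thesis using return[of N] same[of "\<tau> N" \<sigma>] by simp
qed

lemma up_subs: "up t = subs (\<lambda>i. Var (Suc i)) t"
  using lift_subs[of "Suc 0" 0 Var t] by simp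

lemma weaken_union: "\<Gamma> \<turnstile> c \<Longrightarrow> \<Delta> |\<union>| \<Gamma> \<turnstile> c"
  by (induction \<Delta>) (auto intro: derivable_weaken)

lemma cut_union: "\<Delta> |\<union>| \<Gamma> \<turnstile> c \<Longrightarrow> (\<And>g. g |\<in>| \<Delta> \<Longrightarrow> {||} \<turnstile> g) \<Longrightarrow> \<Gamma> \<turnstile> c"
proof (induction \<Delta>)
  case (insert a \<Delta>)
  have "\<Delta> |\<union>| \<Gamma> \<turnstile> a" using weaken_union[of "{||}" a "\<Delta> |\<union>| \<Gamma>"] insert.prems(2) by simp
  then have "\<Delta> |\<union>| \<Gamma> \<turnstile> c" using insert.prems(1) by (auto intro: derivable_cut)
  then show ?case using insert by simp
qed simp

lemma derivable_eq_trans: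
  assumes "\<Gamma> \<turnstile> a \<doteq> b" "\<Gamma> \<turnstile> b \<doteq> c"
  shows "\<Gamma> \<turnstile> a \<doteq> c"
proof -
  obtain v where v: "v \<notin> fv c" by (rule fresh)
  have "\<Gamma> \<turnstile> subst v a (Var v \<doteq> c)"
    by (rule derivable_eq_subst[of _ b])
      (use derivable_eq_sym[OF assms(1)] assms(2) v derivable_wf[OF assms(2)] in \<open>auto simp: subst_fresh\<close>)
  then show ?thesis using v by (simp add: subst_fresh)
qed

lemma derivable_num_N: "\<Gamma> \<turnstile> IsN (num n)"
  by (induction n) (auto intro: derivable_zero_N derivable_suc_N)

lemma derivable_num_neq: "m \<noteq> n \<Longrightarrow> \<Gamma> \<turnstile> Neq (num m) (num n)"
proof (induction m arbitrary: n)
  case 0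
  then show ?case
    by (cases n) (auto intro!: derivable_neq_sym[of _ "Sc _"] derivable_suc_neq_zero derivable_num_N)
next
  case (Suc m)
  then show ?case
    by (cases n) (auto intro: derivable_suc_neq_zero derivable_suc_neq_I derivable_num_N)
qed

lemma derivable_eq_Sc:
  assumes "\<Gamma> \<turnstile> a \<doteq> num n"
  shows "\<Gamma> \<turnstile> Sc a \<doteq> num (Suc n)"
proof -
  have "\<Gamma> \<turnstile> subst 0 a (Sc (Var 0) \<doteq> num (Suc n))"
    by (rule derivable_eq_subst[of _ "num n"])
      (use derivable_eq_sym[OF assms] derivable_num_N[of _ "Suc n"] in auto)
  then show ?thesis by simp
qed

lemma derivable_eq_Eq:
  assumes a: "\<Gamma> \<turnstile> a \<doteq> num m" and b: "\<Gamma> \<turnstile> b \<doteq> num n"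
  shows "\<Gamma> \<turnstile> (a \<doteq> b) \<doteq> num (if m = n then 1 else 0)"
proof (cases "m = n")
  case True
  then show ?thesis using derivable_true_I[OF derivable_eq_trans[OF a derivable_eq_sym]] b by simp
next
  case False
  have "\<Gamma> \<turnstile> subst 0 a (Neq (Var 0) (num n))"
    by (rule derivable_eq_subst[of _ "num m"]) (use False derivable_eq_sym[OF a] in \<open>auto intro: derivable_num_neq\<close>)
  moreover obtain v where "v \<notin> fv a" by (rule fresh)
  ultimately have "\<Gamma> \<turnstile> subst v b (Neq a (Var v))"
    using derivable_eq_subst[of \<Gamma> "num n" b v "Neq a (Var v)"] derivable_eq_sym[OF b] derivable_wf[OF a]
    by (auto simp: subst_fresh)
  then show ?thesis using \<open>v \<notin> fv a\<close> False derivable_false_I[of \<Gamma> "a \<doteq> b"] by (simp add: subst_fresh)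
qed


section \<open>Evaluation with an infinitary quantifier\<close>

text \<open>
  The clauses are those of \<open>eval\<close> and \<open>heval\<close> without the step index, except that \<open>all_tt\<close> and
  \<open>all_ff\<close> also demand the values of the instances that are supposed to be justified by the
  derivation.
\<close>

inductive ev :: "tm \<Rightarrow> nat \<Rightarrow> bool" and hev :: "tm \<Rightarrow> head \<Rightarrow> bool" where
  zero: "ev Zero 0"
| suc: "ev a n \<Longrightarrow> ev (Sc a) (Suc n)"
| eq: "ev a m \<Longrightarrow> ev b n \<Longrightarrow> ev (a \<doteq> b) (if m = n then tt else ff)"
| neg_ff: "ev a ff \<Longrightarrow> ev (Neg a) tt"
| neg_tt: "ev a tt \<Longrightarrow> ev (Neg a) ff"
| or_tt1: "ev a tt \<Longrightarrow> ev (a \<^bold>\<or> b) tt"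
| or_tt2: "ev b tt \<Longrightarrow> ev (a \<^bold>\<or> b) tt"
| or_ff: "ev a ff \<Longrightarrow> ev b ff \<Longrightarrow> ev (a \<^bold>\<or> b) ff"
| beta: "hev t (HLam b) \<Longrightarrow> ev (inst 0 u b) r \<Longrightarrow> ev (t \<cdot> u) r"
| rec0: "hev t (HRec2 g h) \<Longrightarrow> ev m 0 \<Longrightarrow> ev g r \<Longrightarrow> ev (t \<cdot> m) r"
| recS: "hev t (HRec2 g h) \<Longrightarrow> ev m (Suc k) \<Longrightarrow>
    ev (h \<cdot> num k \<cdot> (Rec \<cdot> g \<cdot> h \<cdot> num k)) r \<Longrightarrow> ev (t \<cdot> m) r"
| all_tt: "hev t HAll \<Longrightarrow> {|IsN (Var 0)|} \<turnstile> up u \<cdot> Var 0 \<Longrightarrow> (\<And>n. ev (u \<cdot> num n) tt) \<Longrightarrow>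
    ev (t \<cdot> u) tt"
| all_ff: "hev t HAll \<Longrightarrow> {||} \<turnstile> Neg (u \<cdot> num i) \<Longrightarrow> ev (u \<cdot> num i) ff \<Longrightarrow> ev (t \<cdot> u) ff"
| hlam: "hev (Lam b) (HLam b)"
| hrec: "hev Rec HRec"
| hall: "hev Forall HAll"
| hrec1: "hev t HRec \<Longrightarrow> hev (t \<cdot> g) (HRec1 g)"
| hrec2: "hev t (HRec1 g) \<Longrightarrow> hev (t \<cdot> h) (HRec2 g h)"
| hbeta: "hev t (HLam b) \<Longrightarrow> hev (inst 0 u b) w \<Longrightarrow> hev (t \<cdot> u) w"
| hrec0: "hev t (HRec2 g h) \<Longrightarrow> ev m 0 \<Longrightarrow> hev g w \<Longrightarrow> hev (t \<cdot> m) w"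
| hrecS: "hev t (HRec2 g h) \<Longrightarrow> ev m (Suc k) \<Longrightarrow>
    hev (h \<cdot> num k \<cdot> (Rec \<cdot> g \<cdot> h \<cdot> num k)) w \<Longrightarrow> hev (t \<cdot> m) w"

inductive_cases hev_Var_E: "hev (Var i) w"
inductive_cases ev_Zero_E: "ev Zero r"
inductive_cases ev_Bot_E: "ev Bot r"
inductive_cases ev_Sc_E: "ev (Sc a) r"
inductive_cases ev_Neg_E: "ev (Neg a) r"
inductive_cases ev_Eq_E: "ev (a \<doteq> b) r"
inductive_cases ev_Or_E: "ev (a \<^bold>\<or> b) r"
inductive_cases ev_App_E: "ev (t \<cdot> u) r"
inductive_cases hev_App_E: "hev (t \<cdot> u) w"
inductive_cases ev_Lam_E: "ev (Lam b) r"
inductive_cases hev_Lam_E: "hev (Lam b) w"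
inductive_cases ev_Rec_E: "ev Rec r"
inductive_cases hev_Rec_E: "hev Rec w"
inductive_cases ev_Forall_E: "ev Forall r"
inductive_cases hev_Forall_E: "hev Forall w"
inductive_cases hev_Zero_E: "hev Zero r"
inductive_cases hev_Sc_E: "hev (Sc a) r"
inductive_cases hev_Neg_E: "hev (Neg a) r"
inductive_cases hev_Eq_E: "hev (a \<doteq> b) r"
inductive_cases hev_Or_E: "hev (a \<^bold>\<or> b) r"

lemma ev_Bot [simp]: "\<not> ev Bot r"
  by (auto elim: ev_Bot_E)

lemma ev_Zero [simp]: "ev Zero r \<longleftrightarrow> r = 0"
  by (auto elim: ev_Zero_E intro: zero)

text \<open>
  The inversion rules in the form of equivalences determine \<open>ev\<close> at each term constructor.  Those
  for applications are to be used with the arguments instantiated, since their right-hand sides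
  contain applications again.
\<close>

lemma ev_Sc_iff: "ev (Sc a) r \<longleftrightarrow> (\<exists>n. r = Suc n \<and> ev a n)"
  by (auto elim: ev_Sc_E intro: suc)

lemma ev_Neg_iff: "ev (Neg a) r \<longleftrightarrow> r = 1 \<and> ev a 0 \<or> r = 0 \<and> ev a 1"
  by (auto elim: ev_Neg_E intro: neg_ff neg_tt)

lemma ev_Or_iff:
  "ev (a \<^bold>\<or> b) r \<longleftrightarrow> r = 1 \<and> (ev a 1 \<or> ev b 1) \<or> r = 0 \<and> ev a 0 \<and> ev b 0"
  by (auto elim: ev_Or_E intro: or_tt1 or_tt2 or_ff)

lemma ev_Eq_iff:
  "ev (a \<doteq> b) r \<longleftrightarrow> (\<exists>m n. ev a m \<and> ev b n \<and> r = (if m = n then 1 else 0))"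
  by (rule iffI, erule ev_Eq_E, (rule exI conjI | simp)+, elim exE conjE, simp only: One_nat_def eq)

lemma ev_Sc [simp]: "\<not> ev (Sc a) 0" "ev (Sc a) (Suc n) \<longleftrightarrow> ev a n"
  by (auto simp: ev_Sc_iff)

lemma ev_Neg [simp]: "ev (Neg a) (Suc n) \<longleftrightarrow> n = 0 \<and> ev a 0" "ev (Neg a) 0 \<longleftrightarrow> ev a (Suc 0)"
  by (auto simp: ev_Neg_iff)

lemma ev_Or [simp]:
  "ev (a \<^bold>\<or> b) (Suc n) \<longleftrightarrow> n = 0 \<and> (ev a (Suc 0) \<or> ev b (Suc 0))"
  "ev (a \<^bold>\<or> b) 0 \<longleftrightarrow> ev a 0 \<and> ev b 0"
  by (auto simp: ev_Or_iff)

lemma ev_Eq [simp]: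
  "ev (a \<doteq> b) (Suc r) \<longleftrightarrow> r = 0 \<and> (\<exists>n. ev a n \<and> ev b n)"
  "ev (a \<doteq> b) 0 \<longleftrightarrow> (\<exists>m n. ev a m \<and> ev b n \<and> m \<noteq> n)"
  by (auto simp: ev_Eq_iff split: if_splits)

lemma ev_App_iff: "ev (t \<cdot> u) r \<longleftrightarrow>
    (\<exists>b. hev t (HLam b) \<and> ev (inst 0 u b) r) \<or>
    (\<exists>g h. hev t (HRec2 g h) \<and> ev u 0 \<and> ev g r) \<or>
    (\<exists>g h k. hev t (HRec2 g h) \<and> ev u (Suc k) \<and> ev (h \<cdot> num k \<cdot> (Rec \<cdot> g \<cdot> h \<cdot> num k)) r) \<or>
    (hev t HAll \<and> r = 1 \<and> {|IsN (Var 0)|} \<turnstile> up u \<cdot> Var 0 \<and> (\<forall>n. ev (u \<cdot> num n) 1)) \<or>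
    (hev t HAll \<and> r = 0 \<and> (\<exists>i. {||} \<turnstile> Neg (u \<cdot> num i) \<and> ev (u \<cdot> num i) 0))"
  (is "?l \<longleftrightarrow> ?r")
proof
  show "?l \<Longrightarrow> ?r" by (erule ev_App_E) (simp_all, blast+)
  show "?r \<Longrightarrow> ?l"
    by (elim disjE exE conjE)
      (erule (1) beta, erule (2) rec0, erule (2) recS, simp add: all_tt, simp add: all_ff)
qed

lemma hev_App_iff: "hev (t \<cdot> u) w \<longleftrightarrow>
    (hev t HRec \<and> w = HRec1 u) \<or>
    (\<exists>g. hev t (HRec1 g) \<and> w = HRec2 g u) \<or>
    (\<exists>b. hev t (HLam b) \<and> hev (inst 0 u b) w) \<or>
    (\<exists>g h. hev t (HRec2 g h) \<and> ev u 0 \<and> hev g w) \<or>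
    (\<exists>g h k. hev t (HRec2 g h) \<and> ev u (Suc k) \<and> hev (h \<cdot> num k \<cdot> (Rec \<cdot> g \<cdot> h \<cdot> num k)) w)"
  (is "?l \<longleftrightarrow> ?r")
proof
  show "?l \<Longrightarrow> ?r" by (erule hev_App_E) (simp_all, blast+)
  show "?r \<Longrightarrow> ?l"
    by (elim disjE exE conjE)
      (simp add: hrec1, simp add: hrec2, erule (1) hbeta, erule (2) hrec0, erule (2) hrecS)
qed

lemma ev_num [simp]: "ev (num n) r \<longleftrightarrow> r = n"
  by (induction n arbitrary: r) (auto simp: ev_Sc_iff)

lemma hev_Lam [simp]: "hev (Lam b) w \<longleftrightarrow> w = HLam b" "\<not> ev (Lam b) r"
  by (auto elim: hev_Lam_E ev_Lam_E intro: hlam)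

lemma hev_Rec [simp]: "hev Rec w \<longleftrightarrow> w = HRec" "\<not> ev Rec r"
  by (auto elim: hev_Rec_E ev_Rec_E intro: hrec)

lemma hev_Forall [simp]: "hev Forall w \<longleftrightarrow> w = HAll" "\<not> ev Forall r"
  by (auto elim: hev_Forall_E ev_Forall_E intro: hall)

lemma hev_Rec1 [simp]: "hev (Rec \<cdot> g) w \<longleftrightarrow> w = HRec1 g"
  by (simp add: hev_App_iff[of Rec])

lemma hev_Rec2 [simp]: "hev (Rec \<cdot> g \<cdot> h) w \<longleftrightarrow> w = HRec2 g h"
  by (simp add: hev_App_iff[of "Rec \<cdot> g"])

lemma not_hev [simp]: "\<not> hev (Var i) w" "\<not> hev Zero w" "\<not> hev (Sc a) w" "\<not> hev (Neg a) w"
  "\<not> hev (a \<doteq> b) w" "\<not> hev (a \<^bold>\<or> b) w"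
  by (auto elim: hev_Var_E hev_Zero_E hev_Sc_E hev_Neg_E hev_Eq_E hev_Or_E)

text \<open>
  For quantified terms, determinism does not rest on the consistency of the calculus: the two
  clauses exclude each other because the instance that evaluates to \<open>ff\<close> would evaluate to \<open>tt\<close> as
  well.  Values and heads have to be treated together, as clauses for applications are selected by
  the head of the function.
\<close>

lemma ev_deterministic_aux:
  "ev t r \<Longrightarrow> (\<forall>r'. ev t r' \<longleftrightarrow> r' = r) \<and> (\<forall>w. \<not> hev t w)"
  "hev t w \<Longrightarrow> (\<forall>w'. hev t w' \<longleftrightarrow> w' = w) \<and> (\<forall>r. \<not> ev t r)"
proof (induction rule: ev_hev.inducts)
  case (beta t b u r)
  then show ?case by (auto simp: ev_App_iff[of t u] hev_App_iff[of t u])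
next
  case (rec0 t g h m r)
  then show ?case by (auto simp: ev_App_iff[of t m] hev_App_iff[of t m])
next
  case (recS t g h m k r)
  then show ?case by (auto simp: ev_App_iff[of t m] hev_App_iff[of t m])
next
  case (all_tt t u)
  then show ?case by (auto simp: ev_App_iff[of t u] hev_App_iff[of t u])
next
  case (all_ff t u i)
  then show ?case by (auto simp: ev_App_iff[of t u] hev_App_iff[of t u])
next
  case (hrec1 t g)
  then show ?case by (auto simp: ev_App_iff[of t g] hev_App_iff[of t g])
next
  case (hrec2 t g h)
  then show ?case by (auto simp: ev_App_iff[of t h] hev_App_iff[of t h])
next
  case (hbeta t b u w)
  then show ?case by (auto simp: ev_App_iff[of t u] hev_App_iff[of t u])
next
  case (hrec0 t g h m w)
  then show ?case by (auto simp: ev_App_iff[of t m] hev_App_iff[of t m])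
next
  case (hrecS t g h m k w)
  then show ?case by (auto simp: ev_App_iff[of t m] hev_App_iff[of t m])
qed (auto simp: ev_Sc_iff ev_Neg_iff ev_Or_iff ev_Eq_iff)

lemma ev_deterministic: "ev t r \<Longrightarrow> ev t r' \<Longrightarrow> r' = r"
  using ev_deterministic_aux(1) by blast

lemma ev_not_hev: "ev t r \<Longrightarrow> \<not> hev t w"
  using ev_deterministic_aux(1) by blast

text \<open>
  A head step is what evaluation does at the head of a term, so both sides have the same values
  and the same heads.
\<close>

lemma step_ev:
  "t \<rhd> t' \<Longrightarrow> (\<forall>r. ev t r \<longleftrightarrow> ev t' r) \<and> (\<forall>w. hev t w \<longleftrightarrow> hev t' w)"
proof (induction rule: step.induct)
  case (step_beta t b)
  show ?case by (simp add: ev_App_iff[of "Lam b"] hev_App_iff[of "Lam b"])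
next
  case (step_rec0 h g)
  show ?case by (simp add: ev_App_iff[of "Rec \<cdot> g \<cdot> h"] hev_App_iff[of "Rec \<cdot> g \<cdot> h"])
next
  case (step_recS g h n)
  show ?case by (simp add: ev_App_iff[of "Rec \<cdot> g \<cdot> h" "Sc _"] hev_App_iff[of "Rec \<cdot> g \<cdot> h" "Sc _"])
next
  case (step_app t t' u)
  then show ?case
    by (simp add: ev_App_iff[of t] hev_App_iff[of t] ev_App_iff[of t'] hev_App_iff[of t'])
qed


section \<open>Evaluation is reflected in derivability\<close>

fun head_tm :: "head \<Rightarrow> tm" where
  "head_tm (HLam b) = Lam b"
| "head_tm HRec = Rec"
| "head_tm (HRec1 g) = Rec \<cdot> g"
| "head_tm (HRec2 g h) = Rec \<cdot> g \<cdot> h"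
| "head_tm HAll = Forall"

text \<open>
  The conversion rules speak about equations between whole formulas and presuppose that the
  reduct has a value, while a term with a functional head has none.  Hence a relation between
  functional terms is expressed by the values of their applications to arguments: a value of \<open>t'\<close>,
  applied to any arguments, is provably a value of \<open>t\<close> applied to the same ones.
\<close>

definition refines :: "tm \<Rightarrow> tm \<Rightarrow> bool" where
  "refines t t' \<longleftrightarrow> (\<forall>us k. (\<forall>u\<in>set us. wf_tm u) \<longrightarrow> {||} \<turnstile> foldl (\<cdot>) t' us \<doteq> num k \<longrightarrow>
     {||} \<turnstile> foldl (\<cdot>) t us \<doteq> num k)"

lemma refinesD: "refines t t' \<Longrightarrow> {||} \<turnstile> t' \<doteq> num k \<Longrightarrow> {||} \<turnstile> t \<doteq> num k"
  unfolding refines_def by (drule spec[of _ "[]"]) simp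

lemma refines_refl [simp]: "refines t t"
  by (simp add: refines_def)

lemma refines_trans [trans]: "refines t t' \<Longrightarrow> refines t' t'' \<Longrightarrow> refines t t''"
  by (simp add: refines_def)

lemma refines_App:
  assumes "refines t t'" "wf_tm u"
  shows "refines (t \<cdot> u) (t' \<cdot> u)"
  unfolding refines_def
proof (intro allI impI)
  fix us k assume "\<forall>u\<in>set us. wf_tm u" "{||} \<turnstile> foldl (\<cdot>) (t' \<cdot> u) us \<doteq> num k"
  then show "{||} \<turnstile> foldl (\<cdot>) (t \<cdot> u) us \<doteq> num k"
    using assms(1)[unfolded refines_def, rule_format, of "u # us" k] assms(2) by auto
qed

lemma step_foldl: "t \<rhd> t' \<Longrightarrow> foldl (\<cdot>) t us \<rhd> foldl (\<cdot>) t' us"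
  by (induction us arbitrary: t t') (auto intro: step_app)

lemma refines_step:
  assumes "t \<rhd> t'"
  shows "refines t t'"
  unfolding refines_def
proof (intro allI impI)
  fix us k assume eq: "{||} \<turnstile> foldl (\<cdot>) t' us \<doteq> num k"
  have "{||} \<turnstile> IsN (foldl (\<cdot>) t' us)"
    using derivable_eq_trans[OF eq derivable_eq_sym[OF eq]] .
  then have "{||} \<turnstile> foldl (\<cdot>) t us \<doteq> foldl (\<cdot>) t' us"
    by (rule derivable_conv_eq[OF step_foldl[OF assms]])
  then show "{||} \<turnstile> foldl (\<cdot>) t us \<doteq> num k" using eq by (rule derivable_eq_trans)
qed

lemma subst_foldl: "subst v s (foldl (\<cdot>) t us) = foldl (\<cdot>) (subst v s t) (map (subst v s) us)"
  by (induction us arbitrary: t) auto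

lemma fv_foldl: "fv (foldl (\<cdot>) t us) = fv t \<union> (\<Union>u\<in>set us. fv u)"
  by (induction us arbitrary: t) auto

lemma wf_foldl: "wf_tm (foldl (\<cdot>) t us) \<longleftrightarrow> wf_tm t \<and> (\<forall>u\<in>set us. wf_tm u)"
  by (induction us arbitrary: t) auto

text \<open>
  The recursor reduces only on literal numerals, but evaluation lets it act on any argument with a
  value.  The gap is closed by replacing equals by equals.
\<close>

lemma refines_arg:
  assumes m: "{||} \<turnstile> m \<doteq> num n" and "wf_tm t"
  shows "refines (t \<cdot> m) (t \<cdot> num n)"
  unfolding refines_def
proof (intro allI impI)
  fix us k assume us: "\<forall>u\<in>set us. wf_tm u" and eq: "{||} \<turnstile> foldl (\<cdot>) (t \<cdot> num n) us \<doteq> num k"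
  obtain v where v: "v \<notin> fv (foldl (\<cdot>) t us)" by (rule fresh)
  have inst: "subst v s (foldl (\<cdot>) (t \<cdot> Var v) us \<doteq> num k) = (foldl (\<cdot>) (t \<cdot> s) us \<doteq> num k)" for s
    using v by (simp add: subst_foldl fv_foldl subst_fresh map_idI)
  have "wf_tm (foldl (\<cdot>) (t \<cdot> Var v) us \<doteq> num k)"
    using us assms(2) by (simp add: wf_foldl)
  then show "{||} \<turnstile> foldl (\<cdot>) (t \<cdot> m) us \<doteq> num k"
    using derivable_eq_subst[OF derivable_eq_sym[OF m], of v "foldl (\<cdot>) (t \<cdot> Var v) us \<doteq> num k"] eq
    unfolding inst by simp
qed

lemma derivable_false_iff: "\<Gamma> \<turnstile> a \<doteq> num 0 \<longleftrightarrow> \<Gamma> \<turnstile> Neg a"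
  by (blast intro: derivable_false_I derivable_false_E)

lemma derivable_true_iff: "\<Gamma> \<turnstile> a \<doteq> num (Suc 0) \<longleftrightarrow> \<Gamma> \<turnstile> a"
  by (blast intro: derivable_true_I derivable_true_E)

lemma refines_beta:
  assumes "refines t (Lam b)" "wf_tm u"
  shows "refines (t \<cdot> u) (inst 0 u b)"
  using assms by (blast intro: refines_App refines_step step_beta refines_trans)

lemma refines_rec0:
  assumes "refines t (Rec \<cdot> g \<cdot> h)" "wf_tm g" "wf_tm h" "wf_tm m" "{||} \<turnstile> m \<doteq> num 0"
  shows "refines (t \<cdot> m) g"
proof -
  have "refines (t \<cdot> m) (Rec \<cdot> g \<cdot> h \<cdot> m)" using assms by (intro refines_App)
  also have "refines \<dots> (Rec \<cdot> g \<cdot> h \<cdot> num 0)" using assms by (intro refines_arg) auto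
  also have "refines \<dots> g" using assms by (auto intro: refines_step step_rec0)
  finally show ?thesis .
qed

lemma refines_recS:
  assumes "refines t (Rec \<cdot> g \<cdot> h)" "wf_tm g" "wf_tm h" "wf_tm m" "{||} \<turnstile> m \<doteq> num (Suc k)"
  shows "refines (t \<cdot> m) (h \<cdot> num k \<cdot> (Rec \<cdot> g \<cdot> h \<cdot> num k))"
proof -
  have "refines (t \<cdot> m) (Rec \<cdot> g \<cdot> h \<cdot> m)" using assms by (intro refines_App)
  also have "refines \<dots> (Rec \<cdot> g \<cdot> h \<cdot> num (Suc k))" using assms by (intro refines_arg) auto
  also have "refines \<dots> (h \<cdot> num k \<cdot> (Rec \<cdot> g \<cdot> h \<cdot> num k))"
    using assms by (auto intro: refines_step step_recS)
  finally show ?thesis .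
qed

text \<open>
  The second half says in which sense a term is provably the same as its head.
\<close>

lemma ev_derivable:
  "ev t r \<Longrightarrow> wf_tm t \<Longrightarrow> {||} \<turnstile> t \<doteq> num r"
  "hev t w \<Longrightarrow> wf_tm t \<Longrightarrow> wf_tm (head_tm w) \<and> refines t (head_tm w)"
proof (induction rule: ev_hev.inducts)
  case zero
  then show ?case using derivable_num_N[of _ 0] by simp
next
  case (suc a n)
  then show ?case by (intro derivable_eq_Sc) simp
next
  case (eq a m b n)
  then show ?case using derivable_eq_Eq[of "{||}" a m b n] by (cases "m = n") simp_all
next
  case (neg_ff a)
  then show ?case by (simp only: derivable_false_iff derivable_true_iff wf_node)
next
  case (neg_tt a)
  then show ?case by (simp only: derivable_false_iff derivable_true_iff wf_node derivable_dneg_I)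
next
  case (or_tt1 a b)
  then show ?case by (simp only: derivable_true_iff wf_node derivable_or_I1)
next
  case (or_tt2 a b)
  then show ?case by (simp only: derivable_true_iff wf_node derivable_or_I2)
next
  case (or_ff a b)
  then show ?case by (simp only: derivable_false_iff wf_node derivable_nor_I)
next
  case (beta t b u r)
  then show ?case using refines_beta[of t b u] by (auto simp: wf_inst_0 intro: refinesD)
next
  case (rec0 t g h m r)
  then show ?case using refines_rec0[of t g h m] by (auto intro: refinesD)
next
  case (recS t g h m k r)
  then show ?case using refines_recS[of t g h m k] by (auto intro: refinesD)
next
  case (all_tt t u)
  then have "{||} \<turnstile> Forall \<cdot> u" by (intro derivable_all_I) simp
  with all_tt show ?case
    using refines_App[of t Forall u] refinesD[of "t \<cdot> u" "Forall \<cdot> u" "Suc 0"] derivable_true_I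
    by auto
next
  case (all_ff t u i)
  then have "{||} \<turnstile> Neg (Forall \<cdot> u)" by (intro derivable_nall_I[OF _ derivable_num_N])
  with all_ff show ?case
    using refines_App[of t Forall u] refinesD[of "t \<cdot> u" "Forall \<cdot> u" 0] derivable_false_I
    by auto
next
  case (hrec1 t g)
  then show ?case using refines_App[of t Rec g] by simp
next
  case (hrec2 t g h)
  then show ?case using refines_App[of t "Rec \<cdot> g" h] by simp
next
  case (hbeta t b u w)
  then show ?case using refines_beta[of t b u] by (auto simp: wf_inst_0 intro: refines_trans)
next
  case (hrec0 t g h m w)
  then show ?case using refines_rec0[of t g h m] by (auto intro: refines_trans)
next
  case (hrecS t g h m k w)
  then show ?case using refines_recS[of t g h m k] by (auto intro: refines_trans)
qed simp_all


section \<open>Replacing equals by equals preserves evaluation\<close>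

fun subst_head :: "nat \<Rightarrow> tm \<Rightarrow> head \<Rightarrow> head" where
  "subst_head v a (HLam b) = HLam (subst (Suc v) (up a) b)"
| "subst_head v a HRec = HRec"
| "subst_head v a (HRec1 g) = HRec1 (subst v a g)"
| "subst_head v a (HRec2 g h) = HRec2 (subst v a g) (subst v a h)"
| "subst_head v a HAll = HAll"

lemma subst_eq_Op:
  "Op c k ts = subst v a p \<Longrightarrow> p \<noteq> Var v \<Longrightarrow>
    \<exists>ps. p = Op c k ps \<and> ts = map (subst (v + k) (lift k 0 a)) ps"
  by (cases p) (auto split: if_splits)

text \<open>
  Inversion of \<open>subst_head\<close>: substitution does not change the shape of a head.
\<close>

lemma subst_head_eq:
  "HLam b = subst_head v a W \<Longrightarrow> \<exists>q. W = HLam q \<and> b = subst (Suc v) (up a) q"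
  "HRec = subst_head v a W \<Longrightarrow> W = HRec"
  "HRec1 g = subst_head v a W \<Longrightarrow> \<exists>q. W = HRec1 q \<and> g = subst v a q"
  "HRec2 g h = subst_head v a W \<Longrightarrow> \<exists>q q'. W = HRec2 q q' \<and> g = subst v a q \<and> h = subst v a q'"
  "HAll = subst_head v a W \<Longrightarrow> W = HAll"
  by (cases W; auto)+

text \<open>
  In the quantifier clause, the replacement takes place beneath the variable \<open>Var 0\<close> introduced by
  the clause; the equation is lifted accordingly.
\<close>

lemma derivable_all_premise_cong:
  assumes "{||} \<turnstile> a \<doteq> b" "wf_tm p" "{|IsN (Var 0)|} \<turnstile> up (subst v a p) \<cdot> Var 0"
  shows "{|IsN (Var 0)|} \<turnstile> up (subst v b p) \<cdot> Var 0"
proof -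
  have "{||} \<turnstile> up a \<doteq> up b"
    using derivable_subs[OF assms(1), of "\<lambda>i. Var (Suc i)"] by (simp add: up_subs)
  then have "{|IsN (Var 0)|} \<turnstile> up a \<doteq> up b"
    by (rule derivable_weaken)
  then have "{|IsN (Var 0)|} \<turnstile> subst (Suc v) (up b) (up p \<cdot> Var 0)"
    by (rule derivable_eq_subst) (use assms in \<open>simp_all add: up_subst\<close>)
  then show ?thesis by (simp add: up_subst)
qed

text \<open>
  By induction on the evaluation of \<open>t\<close>, for all ways of reading \<open>t\<close> as an instance of a pattern
  \<open>p\<close> at once.  If \<open>p\<close> is the variable \<open>v\<close> itself, determinism identifies the value with \<open>m\<close>, and a
  head is impossible because \<open>a\<close> has a value.  Otherwise the top operator belongs to \<open>p\<close>, and the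
  clause applied to \<open>t\<close> is repeated for the other instance.  For this, a head of \<open>t\<close> has to be an
  instance of a head of the pattern.  The derivations in the quantifier clauses are transferred by
  the rule of equality, since \<open>a\<close> and \<open>b\<close> are provably equal.
\<close>

lemma ev_subst_cong_gen:
  fixes a b :: tm and m v :: nat
  assumes a: "ev a m" and b: "ev b m" and wf: "wf_tm a" "wf_tm b"
  shows "ev t r \<Longrightarrow> \<forall>p. t = subst v a p \<longrightarrow> wf_tm p \<longrightarrow> ev (subst v b p) r"
    and "hev t w \<Longrightarrow> \<forall>p. t = subst v a p \<longrightarrow> wf_tm p \<longrightarrow>
      (\<exists>W. wf_tm (head_tm W) \<and> w = subst_head v a W \<and> hev (subst v b p) (subst_head v b W))"
proof -
  have eq: "{||} \<turnstile> a \<doteq> b"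
    using ev_derivable(1)[OF a wf(1)] ev_derivable(1)[OF b wf(2)]
    by (blast intro: derivable_eq_trans derivable_eq_sym)
  \<comment> \<open>Folded into predicates, the quantified statements stay opaque to the automation.\<close>
  define P where "P t r \<longleftrightarrow> (\<forall>p. t = subst v a p \<longrightarrow> wf_tm p \<longrightarrow> ev (subst v b p) r)" for t r
  define H where "H t w \<longleftrightarrow> (\<forall>p. t = subst v a p \<longrightarrow> wf_tm p \<longrightarrow>
      (\<exists>W. wf_tm (head_tm W) \<and> w = subst_head v a W \<and> hev (subst v b p) (subst_head v b W)))" for t w
  have P_Op: "P (Op c k ts) r" if "ev (Op c k ts) r"
    and "\<And>ps. ts = map (subst (v + k) (lift k 0 a)) ps \<Longrightarrow> wf_tm (Op c k ps) \<Longrightarrow>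
      ev (subst v b (Op c k ps)) r" for c k ts r
    unfolding P_def
  proof (intro allI impI)
    fix p assume p: "Op c k ts = subst v a p" "wf_tm p"
    show "ev (subst v b p) r"
    proof (cases "p = Var v")
      case True
      then show ?thesis using that(1) p a b ev_deterministic by auto
    next
      case False
      then show ?thesis using subst_eq_Op[OF p(1)] p(2) that(2) by blast
    qed
  qed
  have H_Op: "H (Op c k ts) w" if "hev (Op c k ts) w"
    and "\<And>ps. ts = map (subst (v + k) (lift k 0 a)) ps \<Longrightarrow> wf_tm (Op c k ps) \<Longrightarrow>
      \<exists>W. wf_tm (head_tm W) \<and> w = subst_head v a W \<and> hev (subst v b (Op c k ps)) (subst_head v b W)"
    for c k ts w
    unfolding H_def
  proof (intro allI impI)
    fix p assume p: "Op c k ts = subst v a p" "wf_tm p"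
    have "p \<noteq> Var v" using that(1) p a ev_not_hev by auto
    then obtain ps where "p = Op c k ps" "ts = map (subst (v + k) (lift k 0 a)) ps"
      using subst_eq_Op[OF p(1)] by blast
    then show "\<exists>W. wf_tm (head_tm W) \<and> w = subst_head v a W \<and>
        hev (subst v b p) (subst_head v b W)"
      using that(2) p(2) by blast
  qed
  have P_App: "P (t \<cdot> u) r" if "ev (t \<cdot> u) r"
    and "\<And>q q'. t = subst v a q \<Longrightarrow> u = subst v a q' \<Longrightarrow> wf_tm q \<Longrightarrow> wf_tm q' \<Longrightarrow>
      ev (subst v b q \<cdot> subst v b q') r" for t u r
    by (rule P_Op[OF that(1)]) (auto simp: Cons_eq_map_conv that(2))
  have H_App: "H (t \<cdot> u) w" if "hev (t \<cdot> u) w"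
    and "\<And>q q'. t = subst v a q \<Longrightarrow> u = subst v a q' \<Longrightarrow> wf_tm q \<Longrightarrow> wf_tm q' \<Longrightarrow>
      \<exists>W. wf_tm (head_tm W) \<and> w = subst_head v a W \<and>
        hev (subst v b q \<cdot> subst v b q') (subst_head v b W)" for t u w
    by (rule H_Op[OF that(1)]) (auto simp: Cons_eq_map_conv that(2))
  have PD: "ev (subst v b p) r" if "P (subst v a p) r" "wf_tm p" for p r
    using that by (simp add: P_def)
  have H_HLam: "\<exists>c. wf_tm c \<and> body = subst (Suc v) (up a) c \<and>
      hev (subst v b p) (HLam (subst (Suc v) (up b) c))"
    if "H (subst v a p) (HLam body)" "wf_tm p" for p body
    using that by (fastforce simp: H_def dest: subst_head_eq)
  have H_HRec: "hev (subst v b p) HRec" if "H (subst v a p) HRec" "wf_tm p" for p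
    using that by (fastforce simp: H_def dest: subst_head_eq)
  have H_HAll: "hev (subst v b p) HAll" if "H (subst v a p) HAll" "wf_tm p" for p
    using that by (fastforce simp: H_def dest: subst_head_eq)
  have H_HRec1: "\<exists>c. wf_tm c \<and> g = subst v a c \<and> hev (subst v b p) (HRec1 (subst v b c))"
    if "H (subst v a p) (HRec1 g)" "wf_tm p" for p g
    using that by (fastforce simp: H_def dest: subst_head_eq)
  have H_HRec2: "\<exists>c d. wf_tm c \<and> wf_tm d \<and> g = subst v a c \<and> h = subst v a d \<and>
      hev (subst v b p) (HRec2 (subst v b c) (subst v b d))"
    if "H (subst v a p) (HRec2 g h)" "wf_tm p" for p g h
    using that by (fastforce simp: H_def dest: subst_head_eq)
  have "ev t r \<Longrightarrow> P t r" "hev t w \<Longrightarrow> H t w" for t r w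
  proof (induction rule: ev_hev.inducts)
    case zero
    show ?case by (rule P_Op) auto
  next
    case (suc x n)
    show ?case by (rule P_Op) (use suc in \<open>auto simp: Cons_eq_map_conv intro: PD\<close>)
  next
    case (eq x i y j)
    show ?case
    proof (rule P_Op)
      show "ev (x \<doteq> y) (if i = j then tt else ff)" using eq by (intro ev_hev.eq)
      fix ps assume "[x, y] = map (subst (v + 0) (lift 0 0 a)) ps" "wf_tm (Op 7 0 ps)"
      then obtain q q' where "ps = [q, q']" "x = subst v a q" "y = subst v a q'" "wf_tm q" "wf_tm q'"
        by (auto simp: Cons_eq_map_conv)
      then show "ev (subst v b (Op 7 0 ps)) (if i = j then tt else ff)"
        using eq ev_hev.eq[OF PD PD, of q i q' j] by simp
    qed
  next
    case (neg_ff x)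
    show ?case by (rule P_Op) (use neg_ff in \<open>auto simp: Cons_eq_map_conv intro: PD\<close>)
  next
    case (neg_tt x)
    show ?case by (rule P_Op) (use neg_tt in \<open>auto simp: Cons_eq_map_conv intro: PD\<close>)
  next
    case (or_tt1 x y)
    show ?case by (rule P_Op) (use or_tt1 in \<open>auto simp: Cons_eq_map_conv intro: PD\<close>)
  next
    case (or_tt2 y x)
    show ?case by (rule P_Op) (use or_tt2 in \<open>auto simp: Cons_eq_map_conv intro: PD\<close>)
  next
    case (or_ff x y)
    show ?case by (rule P_Op) (use or_ff in \<open>auto simp: Cons_eq_map_conv intro: PD\<close>)
  next
    case (beta t body u r)
    show ?case
    proof (rule P_App)
      show "ev (t \<cdot> u) r" using beta by (blast intro: ev_hev.beta)
      fix q q' assume q: "t = subst v a q" "u = subst v a q'" "wf_tm q" "wf_tm q'"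
      then obtain c where c: "wf_tm c" "body = subst (Suc v) (up a) c"
        "hev (subst v b q) (HLam (subst (Suc v) (up b) c))"
        using beta.IH(1) H_HLam by blast
      have "ev (subst v b (inst 0 q' c)) r"
        using beta.IH(2) q c by (intro PD) (simp_all add: subst_inst_0 wf_inst_0)
      with c(3) show "ev (subst v b q \<cdot> subst v b q') r"
        by (auto simp: subst_inst_0 intro: ev_hev.beta)
    qed
  next
    case (rec0 t g h n r)
    show ?case
    proof (rule P_App)
      show "ev (t \<cdot> n) r" using rec0 by (blast intro: ev_hev.rec0)
      fix q q' assume q: "t = subst v a q" "n = subst v a q'" "wf_tm q" "wf_tm q'"
      then obtain c d where c: "wf_tm c" "g = subst v a c"
        "hev (subst v b q) (HRec2 (subst v b c) (subst v b d))"
        using rec0.IH(1) H_HRec2 by blast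
      then show "ev (subst v b q \<cdot> subst v b q') r"
        using rec0.IH(2,3) q by (auto intro: ev_hev.rec0 PD)
    qed
  next
    case (recS t g h n k r)
    show ?case
    proof (rule P_App)
      show "ev (t \<cdot> n) r" using recS by (blast intro: ev_hev.recS)
      fix q q' assume q: "t = subst v a q" "n = subst v a q'" "wf_tm q" "wf_tm q'"
      then obtain c d where c: "wf_tm c" "wf_tm d" "g = subst v a c" "h = subst v a d"
        "hev (subst v b q) (HRec2 (subst v b c) (subst v b d))"
        using recS.IH(1) H_HRec2 by blast
      have "ev (subst v b (d \<cdot> num k \<cdot> (Rec \<cdot> c \<cdot> d \<cdot> num k))) r"
        by (rule PD) (use recS.IH(3) c in simp_all)
      moreover have "ev (subst v b q') (Suc k)"
        using recS.IH(2) q by (auto intro: PD)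
      ultimately show "ev (subst v b q \<cdot> subst v b q') r"
        using c(5) by (auto intro: ev_hev.recS)
    qed
  next
    case (all_tt t u)
    show ?case
    proof (rule P_App)
      show "ev (t \<cdot> u) tt" using all_tt by (auto intro: ev_hev.all_tt)
      fix q q' assume q: "t = subst v a q" "u = subst v a q'" "wf_tm q" "wf_tm q'"
      have "ev (subst v b (q' \<cdot> num n)) tt" for n
        by (rule PD) (use all_tt q in simp_all)
      then show "ev (subst v b q \<cdot> subst v b q') tt"
        using all_tt q derivable_all_premise_cong[OF eq, of q' v] H_HAll[of q]
        by (auto intro: ev_hev.all_tt)
    qed
  next
    case (all_ff t u i)
    show ?case
    proof (rule P_App)
      show "ev (t \<cdot> u) 0" using all_ff by (auto intro: ev_hev.all_ff)
      fix q q' assume q: "t = subst v a q" "u = subst v a q'" "wf_tm q" "wf_tm q'"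
      have "ev (subst v b (q' \<cdot> num i)) 0"
        by (rule PD) (use all_ff q in simp_all)
      moreover have "{||} \<turnstile> subst v b (Neg (q' \<cdot> num i))"
        by (rule derivable_eq_subst[OF eq]) (use all_ff q in simp_all)
      ultimately show "ev (subst v b q \<cdot> subst v b q') 0"
        using all_ff q H_HAll[of q] by (auto intro: ev_hev.all_ff)
    qed
  next
    case (hlam body)
    show ?case
    proof (rule H_Op)
      fix ps assume ps: "[body] = map (subst (v + Suc 0) (lift (Suc 0) 0 a)) ps" "wf_tm (Op 6 (Suc 0) ps)"
      then obtain c where "ps = [c]" "body = subst (Suc v) (up a) c" "wf_tm c"
        by (auto simp: Cons_eq_map_conv)
      then show "\<exists>W. wf_tm (head_tm W) \<and> HLam body = subst_head v a W \<and>
          hev (subst v b (Op 6 (Suc 0) ps)) (subst_head v b W)"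
        by (intro exI[of _ "HLam c"]) simp
    qed simp
  next
    case hrec
    show ?case by (rule H_Op) (auto intro!: exI[of _ HRec])
  next
    case hall
    show ?case by (rule H_Op) (auto intro!: exI[of _ HAll])
  next
    case (hrec1 t g)
    show ?case
    proof (rule H_App)
      show "hev (t \<cdot> g) (HRec1 g)" using hrec1 by (blast intro: ev_hev.hrec1)
      fix q q' assume q: "t = subst v a q" "g = subst v a q'" "wf_tm q" "wf_tm q'"
      then show "\<exists>W. wf_tm (head_tm W) \<and> HRec1 g = subst_head v a W \<and>
          hev (subst v b q \<cdot> subst v b q') (subst_head v b W)"
        using hrec1.IH H_HRec by (intro exI[of _ "HRec1 q'"]) (auto intro: ev_hev.hrec1)
    qed
  next
    case (hrec2 t g h)
    show ?case
    proof (rule H_App)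
      show "hev (t \<cdot> h) (HRec2 g h)" using hrec2 by (blast intro: ev_hev.hrec2)
      fix q q' assume q: "t = subst v a q" "h = subst v a q'" "wf_tm q" "wf_tm q'"
      then obtain c where "wf_tm c" "g = subst v a c" "hev (subst v b q) (HRec1 (subst v b c))"
        using hrec2.IH H_HRec1 by blast
      then show "\<exists>W. wf_tm (head_tm W) \<and> HRec2 g h = subst_head v a W \<and>
          hev (subst v b q \<cdot> subst v b q') (subst_head v b W)"
        using q by (intro exI[of _ "HRec2 c q'"]) (auto intro: ev_hev.hrec2)
    qed
  next
    case (hbeta t body u w)
    show ?case
    proof (rule H_App)
      show "hev (t \<cdot> u) w" using hbeta by (blast intro: ev_hev.hbeta)
      fix q q' assume q: "t = subst v a q" "u = subst v a q'" "wf_tm q" "wf_tm q'"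
      then obtain c where c: "wf_tm c" "body = subst (Suc v) (up a) c"
        "hev (subst v b q) (HLam (subst (Suc v) (up b) c))"
        using hbeta.IH(1) H_HLam by blast
      have "H (subst v a (inst 0 q' c)) w" "wf_tm (inst 0 q' c)"
        using hbeta.IH(2) q c by (simp_all add: subst_inst_0 wf_inst_0)
      then have "\<exists>W. wf_tm (head_tm W) \<and> w = subst_head v a W \<and>
          hev (subst v b (inst 0 q' c)) (subst_head v b W)"
        unfolding H_def by blast
      then show "\<exists>W. wf_tm (head_tm W) \<and> w = subst_head v a W \<and>
          hev (subst v b q \<cdot> subst v b q') (subst_head v b W)"
        using c(3) by (auto simp: subst_inst_0 intro: ev_hev.hbeta)
    qed
  next
    case (hrec0 t g h n w)
    show ?case
    proof (rule H_App)
      show "hev (t \<cdot> n) w" using hrec0 by (blast intro: ev_hev.hrec0)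
      fix q q' assume q: "t = subst v a q" "n = subst v a q'" "wf_tm q" "wf_tm q'"
      then obtain c d where c: "wf_tm c" "g = subst v a c"
        "hev (subst v b q) (HRec2 (subst v b c) (subst v b d))"
        using hrec0.IH(1) H_HRec2 by blast
      have "\<exists>W. wf_tm (head_tm W) \<and> w = subst_head v a W \<and> hev (subst v b c) (subst_head v b W)"
        using hrec0.IH(3) c by (simp add: H_def)
      moreover have "ev (subst v b q') 0"
        using hrec0.IH(2) q by (auto intro: PD)
      ultimately show "\<exists>W. wf_tm (head_tm W) \<and> w = subst_head v a W \<and>
          hev (subst v b q \<cdot> subst v b q') (subst_head v b W)"
        using c(3) by (blast intro: ev_hev.hrec0)
    qed
  next
    case (hrecS t g h n k w)
    show ?case
    proof (rule H_App)
      show "hev (t \<cdot> n) w" using hrecS by (blast intro: ev_hev.hrecS)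
      fix q q' assume q: "t = subst v a q" "n = subst v a q'" "wf_tm q" "wf_tm q'"
      then obtain c d where c: "wf_tm c" "wf_tm d" "g = subst v a c" "h = subst v a d"
        "hev (subst v b q) (HRec2 (subst v b c) (subst v b d))"
        using hrecS.IH(1) H_HRec2 by blast
      let ?r = "d \<cdot> num k \<cdot> (Rec \<cdot> c \<cdot> d \<cdot> num k)"
      have "H (subst v a ?r) w" "wf_tm ?r" using hrecS.IH(3) c by simp_all
      then have "\<exists>W. wf_tm (head_tm W) \<and> w = subst_head v a W \<and>
          hev (subst v b ?r) (subst_head v b W)"
        unfolding H_def by blast
      moreover have "ev (subst v b q') (Suc k)"
        using hrecS.IH(2) q by (auto intro: PD)
      ultimately show "\<exists>W. wf_tm (head_tm W) \<and> w = subst_head v a W \<and>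
          hev (subst v b q \<cdot> subst v b q') (subst_head v b W)"
        using c(5) by (auto intro: ev_hev.hrecS)
    qed
  qed
  then show "ev t r \<Longrightarrow> \<forall>p. t = subst v a p \<longrightarrow> wf_tm p \<longrightarrow> ev (subst v b p) r"
    and "hev t w \<Longrightarrow> \<forall>p. t = subst v a p \<longrightarrow> wf_tm p \<longrightarrow>
      (\<exists>W. wf_tm (head_tm W) \<and> w = subst_head v a W \<and> hev (subst v b p) (subst_head v b W))"
    by (simp_all add: P_def H_def)
qed

lemma ev_subst_cong:
  assumes "ev a m" "ev b m" "wf_tm a" "wf_tm b" "wf_tm p"
  shows "ev (subst v a p) r \<Longrightarrow> ev (subst v b p) r"
  using ev_subst_cong_gen(1)[OF assms(1-4)] assms(5) by blast

lemma ev_App_arg_cong: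
  assumes "ev a m" "ev b m" "wf_tm a" "wf_tm b" "wf_tm t" "ev (t \<cdot> a) r"
  shows "ev (t \<cdot> b) r"
proof -
  obtain v where "v \<notin> fv t" by (rule fresh)
  then show ?thesis
    using ev_subst_cong[OF assms(1-4), of "t \<cdot> Var v" v r] assms(5,6) by (simp add: subst_fresh)
qed

section \<open>Soundness\<close>

lemma subs_subst: "subs \<sigma> (subst v s t) = subs (\<sigma>(v := subs \<sigma> s)) t"
  by (auto simp: subst_subs subs_subs intro: subs_cong)

text \<open>
  The substitutions \<open>\<sigma>(v := a)\<close>, for varying \<open>a\<close>, fit into one pattern \<open>q\<close>: first send \<open>v\<close> to a
  fresh variable \<open>w\<close>, then replace \<open>w\<close>.
\<close>

lemma subs_upd_eq_subst:
  assumes "\<And>i. wf_tm (\<sigma> i)" "wf_tm p"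
  obtains w q where "\<And>a. subs (\<sigma>(v := a)) p = subst w a q" "wf_tm q"
proof -
  have "finite (\<Union>i\<in>fv p. fv (\<sigma> i))" by (simp add: finite_fv)
  then obtain w where w: "\<And>i. i \<in> fv p \<Longrightarrow> w \<notin> fv (\<sigma> i)"
    using ex_new_if_finite[OF infinite_UNIV_nat] by blast
  have "subs (\<sigma>(v := a)) p = subst w a (subs (\<sigma>(v := Var w)) p)" for a
  proof -
    have "subst w a (subs (\<sigma>(v := Var w)) p) = subs (\<lambda>i. subst w a ((\<sigma>(v := Var w)) i)) p"
      by (simp only: subst_subs subs_subs)
    also have "\<dots> = subs (\<sigma>(v := a)) p"
      by (rule subs_cong) (use w in \<open>auto simp: subst_fresh\<close>)
    finally show ?thesis by simp
  qed
  then show thesis by (rule that) (simp add: wf_subs assms)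
qed

lemma ev_subs_upd_cong:
  assumes "ev a m" "ev b m" "wf_tm a" "wf_tm b" "wf_tm p" "\<And>i. wf_tm (\<sigma> i)"
    and "ev (subs (\<sigma>(v := a)) p) r"
  shows "ev (subs (\<sigma>(v := b)) p) r"
proof -
  obtain w q where "\<And>a. subs (\<sigma>(v := a)) p = subst w a q" "wf_tm q"
    by (rule subs_upd_eq_subst[OF assms(6,5)]) (rule that; assumption)
  then show ?thesis using ev_subst_cong[OF assms(1-4), of q w r] assms(7) by simp
qed

text \<open>
  The substitution may map variables to terms without a value: in RGA, variables range over all
  terms, and only a hypothesis \<open>IsN (Var i)\<close> restricts them to values.  This also covers the
  identity substitution, and thus open terms.
\<close>

definition valid :: "tm fset \<Rightarrow> tm \<Rightarrow> bool" where
  "valid \<Gamma> c \<longleftrightarrow> (\<forall>\<sigma>. (\<forall>i. wf_tm (\<sigma> i)) \<longrightarrow> (\<forall>g. g |\<in>| \<Gamma> \<longrightarrow> ev (subs \<sigma> g) tt) \<longrightarrow> ev (subs \<sigma> c) tt)"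

lemma ev_true_derivable: "ev a tt \<Longrightarrow> wf_tm a \<Longrightarrow> {||} \<turnstile> a"
  using ev_derivable(1)[of a "Suc 0"] by (simp only: derivable_true_iff)

lemma ev_false_derivable: "ev a ff \<Longrightarrow> wf_tm a \<Longrightarrow> {||} \<turnstile> Neg a"
  using ev_derivable(1)[of a 0] by (simp only: derivable_false_iff)

text \<open>
  The derivation required by \<open>all_tt\<close>, extracted from a premise of quantifier introduction.  Its
  hypotheses, once substituted, evaluate to \<open>tt\<close>; hence they are derivable and can be cut.
\<close>

lemma derivable_all_premise:
  assumes der: "finsert (IsN (Var 0)) (up |`| \<Gamma>) \<turnstile> up f \<cdot> Var 0"
    and wf_\<Gamma>: "\<And>g. g |\<in>| \<Gamma> \<Longrightarrow> wf_tm g" and wf_\<sigma>: "\<And>i. wf_tm (\<sigma> i)"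
    and true: "\<And>g. g |\<in>| \<Gamma> \<Longrightarrow> ev (subs \<sigma> g) tt"
  shows "{|IsN (Var 0)|} \<turnstile> up (subs \<sigma> f) \<cdot> Var 0"
proof -
  let ?\<tau> = "under (Suc 0) \<sigma>"
  have "wf_tm (?\<tau> i)" for i using wf_\<sigma> by (simp add: under_def)
  then have "subs ?\<tau> |`| finsert (IsN (Var 0)) (up |`| \<Gamma>) \<turnstile> subs ?\<tau> (up f \<cdot> Var 0)"
    using wf_\<Gamma> by (intro derivable_subs[OF der]) auto
  moreover have "subs ?\<tau> |`| finsert (IsN (Var 0)) (up |`| \<Gamma>)
      = ((\<lambda>g. up (subs \<sigma> g)) |`| \<Gamma>) |\<union>| {|IsN (Var 0)|}"
    by (auto simp: fset.map_comp comp_def subs_under_up) (simp_all add: under_def)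
  ultimately have "((\<lambda>g. up (subs \<sigma> g)) |`| \<Gamma>) |\<union>| {|IsN (Var 0)|} \<turnstile> up (subs \<sigma> f) \<cdot> Var 0"
    by (simp add: subs_under_up) (simp add: under_def)
  then show ?thesis
  proof (rule cut_union)
    fix g' assume "g' |\<in>| (\<lambda>g. up (subs \<sigma> g)) |`| \<Gamma>"
    then obtain g where g: "g' = up (subs \<sigma> g)" "g |\<in>| \<Gamma>" by auto
    then have "{||} \<turnstile> subs \<sigma> g"
      using wf_\<Gamma> wf_\<sigma> true by (intro ev_true_derivable) (auto simp: wf_subs)
    then show "{||} \<turnstile> g'"
      using derivable_subs[of "{||}" "subs \<sigma> g" "\<lambda>i. Var (Suc i)"] g by (simp add: up_subs)
  qed
qed

lemma ev_Eq_Sc: "ev (Sc a \<doteq> Sc b) r \<longleftrightarrow> ev (a \<doteq> b) r"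
  by (fastforce simp: ev_Eq_iff ev_Sc_iff)

text \<open>
  The context has to be well-formed because quantifier introduction makes use of the derivability
  of its instances.  The hypotheses discharged by a rule are well-formed as parts of derivable
  conclusions, so that the assumption is passed on to the premises.  The rules of logic and
  arithmetic are read off from the clauses of \<open>ev\<close>, with determinism for the rule of contradiction.
  Equality, induction, the recursor and the quantifier rules about a term \<open>a\<close> pass between terms
  of the same value by congruence, and conversion uses the invariance under head steps.
\<close>

lemma derivable_sound:
  assumes "\<Gamma> \<turnstile> c"
  shows "(\<forall>g. g |\<in>| \<Gamma> \<longrightarrow> wf_tm g) \<longrightarrow> valid \<Gamma> c"
  using assms
proof (induction rule: derivable_induct)
  case (follows \<Gamma> c)
  show ?case
  proof
    assume wf_\<Gamma>: "\<forall>g. g |\<in>| \<Gamma> \<longrightarrow> wf_tm g"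
    show "valid \<Gamma> c"
      unfolding valid_def
    proof (intro allI impI)
      fix \<sigma> assume wf_\<sigma>: "\<forall>i. wf_tm (\<sigma> i)" and true: "\<forall>g. g |\<in>| \<Gamma> \<longrightarrow> ev (subs \<sigma> g) tt"
      define E where
        "E = {(\<Gamma>, c). \<Gamma> \<turnstile> c \<and> ((\<forall>g. g |\<in>| \<Gamma> \<longrightarrow> wf_tm g) \<longrightarrow> valid \<Gamma> c)}"
      have der: "\<Delta> \<turnstile> d" if "(\<Delta>, d) \<in> E" for \<Delta> d
        using that by (simp add: E_def)
      note wf = derivable_wf[OF der]
      have gen: "ev (subs \<tau> d) tt" if "(\<Delta>, d) \<in> E" "\<And>g. g |\<in>| \<Delta> \<Longrightarrow> wf_tm g" "\<And>i. wf_tm (\<tau> i)"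
        "\<And>g. g |\<in>| \<Delta> \<Longrightarrow> ev (subs \<tau> g) tt" for \<Delta> d \<tau>
        using that by (auto simp: valid_def E_def)
      have IH: "ev (subs \<sigma> d) tt" if "(\<Gamma>, d) \<in> E" for d
        by (rule gen[OF that]) (use wf_\<Gamma> wf_\<sigma> true in simp_all)
      have IH_insert: "ev (subs \<sigma> d) tt"
        if "(finsert a \<Gamma>, d) \<in> E" "wf_tm a" "ev (subs \<sigma> a) tt" for a d
        by (rule gen[OF that(1)]) (use that(2,3) wf_\<Gamma> wf_\<sigma> true in auto)
      have wf_num_case: "wf_tm (case_nat (num n) \<sigma> i)" for n i
        using wf_\<sigma> by (cases i) simp_all
      have "follows E (\<Gamma>, c)" using follows by (simp add: E_def)
      then show "ev (subs \<sigma> c) tt"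
      proof (cases rule: follows.cases)
        case (hyp \<Delta>)
        then show ?thesis using true by simp
      next
        case (weaken \<Delta> a)
        then show ?thesis using gen[of \<Delta> c \<sigma>] wf_\<Gamma> wf_\<sigma> true by auto
      next
        case (cut a)
        then show ?thesis using IH IH_insert wf by blast
      next
        case (substitution \<Delta> d s v)
        have "ev (subs (\<sigma>(v := subs \<sigma> s)) d) tt"
        proof (rule gen[OF substitution(3)])
          fix g assume "g |\<in>| \<Delta>"
          then have "ev (subs \<sigma> (subst v s g)) tt" using substitution(1) true by simp
          then show "ev (subs (\<sigma>(v := subs \<sigma> s)) g) tt" by (simp add: subs_subst)
        qed (use substitution(4,6) wf_\<sigma> in \<open>simp_all add: wf_subs\<close>)
        then show ?thesis using substitution by (simp add: subs_subst)
      next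
        case (true_I a)
        then show ?thesis by (auto dest!: IH)
      next
        case true_E
        then show ?thesis by (auto dest!: IH simp: ev_Sc_iff)
      next
        case (false_I a)
        then show ?thesis by (auto dest!: IH)
      next
        case (false_E a)
        then show ?thesis by (auto dest!: IH)
      next
        case (neg_E a)
        then show ?thesis by (auto dest!: IH dest: ev_deterministic)
      next
        case (dneg_I a)
        then show ?thesis by (auto dest!: IH)
      next
        case dneg_E
        then show ?thesis by (auto dest!: IH)
      next
        case (or_I1 a b)
        then show ?thesis by (auto dest!: IH)
      next
        case (or_I2 b a)
        then show ?thesis by (auto dest!: IH)
      next
        case (nor_I a b)
        then show ?thesis by (auto dest!: IH)
      next
        case (or_E a b)
        have "wf_tm a" "wf_tm b" using wf[OF or_E(1)] by simp_all
        then show ?thesis using IH[OF or_E(1)] IH_insert[OF or_E(2)] IH_insert[OF or_E(3)] by auto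
      next
        case (nor_E1 a b)
        then show ?thesis by (auto dest!: IH)
      next
        case (nor_E2 a b)
        then show ?thesis by (auto dest!: IH)
      next
        case (isN_eq a)
        then show ?thesis by (auto dest!: IH)
      next
        case (eq_sym a b)
        then show ?thesis by (auto dest!: IH)
      next
        case (eq_subst a b v p)
        obtain m where m: "ev (subs \<sigma> a) m" "ev (subs \<sigma> b) m"
          using IH[OF eq_subst(2)] by auto
        have wfs: "wf_tm (subs \<sigma> a)" "wf_tm (subs \<sigma> b)"
          using wf[OF eq_subst(2)] wf_\<sigma> by (simp_all add: wf_subs)
        have "ev (subs (\<sigma>(v := subs \<sigma> a)) p) tt"
          using IH[OF eq_subst(3)] by (simp add: subs_subst)
        then have "ev (subs (\<sigma>(v := subs \<sigma> b)) p) tt"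
          using wf_\<sigma> by (intro ev_subs_upd_cong[OF m wfs eq_subst(4)]) simp_all
        then show ?thesis using eq_subst(1) by (simp add: subs_subst)
      next
        case (neq_sym a b)
        then show ?thesis by (fastforce dest!: IH)
      next
        case (eq_B_I a b)
        then obtain m n where "ev (subs \<sigma> a) m" "ev (subs \<sigma> b) n" by (auto dest!: IH)
        then have "ev (subs \<sigma> a \<doteq> subs \<sigma> b) (if m = n then tt else ff)" by (rule ev_hev.eq)
        then show ?thesis using eq_B_I(1) by (cases "m = n") (simp_all del: ev_Eq)
      next
        case (eq_B_E a b)
        then show ?thesis by (auto dest!: IH)
      next
        case zero_N
        then show ?thesis by simp
      next
        case (suc_N_I a)
        then show ?thesis by (auto dest!: IH simp: ev_Sc_iff)
      next
        case (suc_N_E a)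
        then show ?thesis by (auto dest!: IH simp: ev_Sc_iff)
      next
        case (suc_neq_zero a)
        then obtain m where "ev (subs \<sigma> a) m" by (auto dest!: IH)
        then have "ev (Sc (subs \<sigma> a) \<doteq> Zero) ff"
          using ev_hev.eq[OF ev_hev.suc ev_hev.zero] by simp
        then show ?thesis using suc_neq_zero(1) by (simp del: ev_Eq)
      next
        case (suc_neq_I a b)
        then show ?thesis using IH[OF suc_neq_I(2)] by (simp add: ev_Eq_Sc del: ev_Eq)
      next
        case (suc_neq_E a b)
        then show ?thesis using IH[OF suc_neq_E(2)] by (simp add: ev_Eq_Sc del: ev_Eq)
      next
        case (suc_inj a b)
        then show ?thesis using IH[OF suc_inj(2)] by (simp add: ev_Eq_Sc del: ev_Eq)
      next
        case bot_E
        then show ?thesis by (auto dest!: IH)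
      next
        case (induction i d a)
        have numeral: "ev (subs (\<sigma>(i := num n)) d) tt" for n
        proof (induction n)
          case 0
          then show ?case using IH[OF induction(2)] by (simp add: subs_subst fun_upd_def)
        next
          case (Suc n)
          have "subs (\<sigma>(i := num n)) g = subs \<sigma> g" if "g |\<in>| \<Gamma>" for g
            using induction(6) that by (intro subs_cong) auto
          \<comment> \<open>The induction step of the rule, read under the substitution that sends \<open>i\<close> to \<open>num n\<close>.\<close>
          then have "ev (subs (\<sigma>(i := num n)) (subst i (Sc (Var i)) d)) tt"
            using Suc induction(5) wf_\<Gamma> wf_\<sigma> true by (intro gen[OF induction(3)]) (auto simp: fun_upd_def)
          then have "ev (subs (\<sigma>(i := num (Suc n))) d) tt" by (simp add: subs_subst)
          then show ?case .
        qed
        obtain k where k: "ev (subs \<sigma> a) k" using IH[OF induction(4)] by auto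
        have "wf_tm (subs \<sigma> a)" using wf[OF induction(4)] wf_\<sigma> by (simp add: wf_subs)
        then have "ev (subs (\<sigma>(i := subs \<sigma> a)) d) tt"
          using numeral[of k] wf_\<sigma>
          by (intro ev_subs_upd_cong[OF _ k _ _ induction(5), of "num k"]) simp_all
        then show ?thesis using induction(1) by (simp add: subs_subst)
      next
        case (conv_expand d)
        then show ?thesis using IH step_ev step_subs wf_\<sigma> by blast
      next
        case (conv_reduce d)
        then show ?thesis using IH step_ev step_subs wf_\<sigma> by blast
      next
        case (conv_eq d d')
        have "subs \<sigma> d \<rhd> subs \<sigma> d'" using conv_eq(2) wf_\<sigma> by (simp add: step_subs)
        then show ?thesis using conv_eq(1) IH[OF conv_eq(3)] step_ev by auto
      next
        case (recursor m h g)
        let ?m = "subs \<sigma> m" and ?h = "subs \<sigma> h" and ?g = "subs \<sigma> g"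
        obtain k where k: "ev ?m k" using IH[OF recursor(2)] by auto
        obtain r where r: "ev (?h \<cdot> ?m \<cdot> (Rec \<cdot> ?g \<cdot> ?h \<cdot> ?m)) r" using IH[OF recursor(3)] by auto
        have wfs: "wf_tm ?m" "wf_tm ?h" "wf_tm ?g"
          using wf[OF recursor(3)] wf_\<sigma> by (simp_all add: wf_subs)
        obtain v where "v \<notin> fv (?h \<cdot> ?g)" by (rule fresh)
        then have "v \<notin> fv ?h" "v \<notin> fv ?g" by simp_all
        then have "ev (?h \<cdot> num k \<cdot> (Rec \<cdot> ?g \<cdot> ?h \<cdot> num k)) r"
          using ev_subst_cong[of ?m k "num k" "?h \<cdot> Var v \<cdot> (Rec \<cdot> ?g \<cdot> ?h \<cdot> Var v)" v r] k r wfs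
          by (simp add: subst_fresh)
        then have "ev (Rec \<cdot> ?g \<cdot> ?h \<cdot> Sc ?m) r"
          using k by (auto intro: ev_hev.recS)
        then show ?thesis using recursor(1) r by auto
      next
        case (all_I f)
        have "{|IsN (Var 0)|} \<turnstile> up (subs \<sigma> f) \<cdot> Var 0"
          using wf_\<Gamma> wf_\<sigma> true by (intro derivable_all_premise[OF der[OF all_I(2)]]) auto
        moreover have "ev (subs \<sigma> f \<cdot> num n) tt" for n
        proof -
          have "ev (subs (case_nat (num n) \<sigma>) (up f \<cdot> Var 0)) tt"
            using wf_\<Gamma> true wf_num_case by (intro gen[OF all_I(2)]) auto
          then show ?thesis by simp
        qed
        ultimately show ?thesis using all_I(1) by (auto intro: ev_hev.all_tt hall)
      next
        case (all_E f a)
        obtain k where k: "ev (subs \<sigma> a) k" using IH[OF all_E(3)] by auto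
        have "ev (subs \<sigma> f \<cdot> num k) tt"
          using IH[OF all_E(2)] by (simp add: ev_App_iff[of Forall])
        moreover have "wf_tm (subs \<sigma> f)" "wf_tm (subs \<sigma> a)"
          using wf[OF all_E(2)] wf[OF all_E(3)] wf_\<sigma> by (simp_all add: wf_subs)
        ultimately show ?thesis
          using ev_App_arg_cong[of "num k" k "subs \<sigma> a" "subs \<sigma> f" tt] k all_E(1) by simp
      next
        case (nall_I f a)
        obtain k where k: "ev (subs \<sigma> a) k" using IH[OF nall_I(3)] by auto
        have wfs: "wf_tm (subs \<sigma> f)" "wf_tm (subs \<sigma> a)"
          using wf[OF nall_I(2)] wf_\<sigma> by (simp_all add: wf_subs)
        have false: "ev (subs \<sigma> f \<cdot> num k) ff"
          using ev_App_arg_cong[of "subs \<sigma> a" k "num k" "subs \<sigma> f" ff] k wfs IH[OF nall_I(2)] by simp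
        then have "{||} \<turnstile> Neg (subs \<sigma> f \<cdot> num k)"
          using wfs by (intro ev_false_derivable) simp_all
        then have "ev (Forall \<cdot> subs \<sigma> f) ff"
          using false by (rule ev_hev.all_ff[OF hall])
        then show ?thesis using nall_I(1) by simp
      next
        case (nall_E f)
        obtain n where n: "ev (subs \<sigma> f \<cdot> num n) ff"
          using IH[OF nall_E(1)] by (auto simp: ev_App_iff[of Forall])
        have "wf_tm f" using wf[OF nall_E(1)] by simp
        then have "ev (subs (case_nat (num n) \<sigma>) (up c)) tt"
          using n wf_\<Gamma> true wf_num_case by (intro gen[OF nall_E(2)]) auto
        then show ?thesis by simp
      qed
    qed
  qed
qed

section \<open>Bounded evaluation\<close>

lemmas eventually_SucD = eventually_sequentially_Suc[THEN iffD1]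

text \<open>
  With "for all sufficiently large step indices" instead of "for some", finitely many premises
  have a common step index, and bounds on the codes of proofs can be met at the same time.
\<close>

lemma ev_imp_eval:
  "ev t r \<Longrightarrow> \<forall>\<^sub>F s in sequentially. eval code s t r"
  "hev t w \<Longrightarrow> \<forall>\<^sub>F s in sequentially. heval code s t w"
proof (induction rule: ev_hev.inducts)
  case zero
  have "\<forall>\<^sub>F s in sequentially. eval code (Suc s) Zero 0"
    by (simp add: ev_zero)
  then show ?case by - (rule eventually_SucD)
next
  case (suc a n)
  have "\<forall>\<^sub>F s in sequentially. eval code (Suc s) (Sc a) (Suc n)"
    using suc.IH by eventually_elim (rule ev_suc)
  then show ?case by - (rule eventually_SucD)
next
  case (eq a m b n)
  have "\<forall>\<^sub>F s in sequentially. eval code (Suc s) (a \<doteq> b) (if m = n then tt else ff)"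
    using eq.IH by eventually_elim (rule ev_eq)
  then show ?case by - (rule eventually_SucD)
next
  case (neg_ff a)
  have "\<forall>\<^sub>F s in sequentially. eval code (Suc s) (Neg a) tt"
    using neg_ff.IH by eventually_elim (rule ev_neg_ff)
  then show ?case by - (rule eventually_SucD)
next
  case (neg_tt a)
  have "\<forall>\<^sub>F s in sequentially. eval code (Suc s) (Neg a) ff"
    using neg_tt.IH by eventually_elim (rule ev_neg_tt)
  then show ?case by - (rule eventually_SucD)
next
  case (or_tt1 a b)
  have "\<forall>\<^sub>F s in sequentially. eval code (Suc s) (a \<^bold>\<or> b) tt"
    using or_tt1.IH by eventually_elim (rule ev_or_tt1)
  then show ?case by - (rule eventually_SucD)
next
  case (or_tt2 b a)
  have "\<forall>\<^sub>F s in sequentially. eval code (Suc s) (a \<^bold>\<or> b) tt"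
    using or_tt2.IH by eventually_elim (rule ev_or_tt2)
  then show ?case by - (rule eventually_SucD)
next
  case (or_ff a b)
  have "\<forall>\<^sub>F s in sequentially. eval code (Suc s) (a \<^bold>\<or> b) ff"
    using or_ff.IH by eventually_elim (rule ev_or_ff)
  then show ?case by - (rule eventually_SucD)
next
  case (beta t b u r)
  have "\<forall>\<^sub>F s in sequentially. eval code (Suc s) (t \<cdot> u) r"
    using beta.IH by eventually_elim (rule ev_beta)
  then show ?case by - (rule eventually_SucD)
next
  case (rec0 t g h m r)
  have "\<forall>\<^sub>F s in sequentially. eval code (Suc s) (t \<cdot> m) r"
    using rec0.IH by eventually_elim (rule ev_rec0)
  then show ?case by - (rule eventually_SucD)
next
  case (recS t g h m k r)
  have "\<forall>\<^sub>F s in sequentially. eval code (Suc s) (t \<cdot> m) r"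
    using recS.IH by eventually_elim (rule ev_recS)
  then show ?case by - (rule eventually_SucD)
next
  case (all_tt t u)
  obtain P where P: "proves P ({|IsN (Var 0)|}, up u \<cdot> Var 0)"
    using all_tt.hyps(2) by (auto simp: derivable_def)
  have "\<forall>\<^sub>F s in sequentially. eval code (Suc s) (t \<cdot> u) tt"
    using all_tt.IH(1) eventually_ge_at_top[of "code P"]
    by eventually_elim (rule ev_all_tt[OF _ _ P])
  then show ?case by - (rule eventually_SucD)
next
  case (all_ff t u i)
  obtain P where P: "proves P ({||}, Neg (u \<cdot> num i))"
    using all_ff.hyps(2) by (auto simp: derivable_def)
  have "\<forall>\<^sub>F s in sequentially. eval code (Suc s) (t \<cdot> u) ff"
    using all_ff.IH(1) eventually_ge_at_top[of "code P"]
    by eventually_elim (rule ev_all_ff[OF _ _ P])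
  then show ?case by - (rule eventually_SucD)
next
  case (hlam b)
  have "\<forall>\<^sub>F s in sequentially. heval code (Suc s) (Lam b) (HLam b)"
    by (simp add: hd_lam)
  then show ?case by - (rule eventually_SucD)
next
  case hrec
  have "\<forall>\<^sub>F s in sequentially. heval code (Suc s) Rec HRec"
    by (simp add: hd_rec)
  then show ?case by - (rule eventually_SucD)
next
  case hall
  have "\<forall>\<^sub>F s in sequentially. heval code (Suc s) Forall HAll"
    by (simp add: hd_all)
  then show ?case by - (rule eventually_SucD)
next
  case (hrec1 t g)
  have "\<forall>\<^sub>F s in sequentially. heval code (Suc s) (t \<cdot> g) (HRec1 g)"
    using hrec1.IH by eventually_elim (rule hd_rec1)
  then show ?case by - (rule eventually_SucD)
next
  case (hrec2 t g h)
  have "\<forall>\<^sub>F s in sequentially. heval code (Suc s) (t \<cdot> h) (HRec2 g h)"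
    using hrec2.IH by eventually_elim (rule hd_rec2)
  then show ?case by - (rule eventually_SucD)
next
  case (hbeta t b u w)
  have "\<forall>\<^sub>F s in sequentially. heval code (Suc s) (t \<cdot> u) w"
    using hbeta.IH by eventually_elim (rule hd_beta)
  then show ?case by - (rule eventually_SucD)
next
  case (hrec0 t g h m w)
  have "\<forall>\<^sub>F s in sequentially. heval code (Suc s) (t \<cdot> m) w"
    using hrec0.IH by eventually_elim (rule hd_rec0)
  then show ?case by - (rule eventually_SucD)
next
  case (hrecS t g h m k w)
  have "\<forall>\<^sub>F s in sequentially. heval code (Suc s) (t \<cdot> m) w"
    using hrecS.IH by eventually_elim (rule hd_recS)
  then show ?case by - (rule eventually_SucD)
qed

theorem theorem4p6:
  fixes code :: "jdg list \<Rightarrow> nat" and t :: tm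
  assumes "inj_on code {P. valid_proof P}"
    and "{||} \<turnstile> IsN t"
  shows "\<exists>s k. eval code s t k"
proof -
  have "valid {||} (IsN t)" using derivable_sound[OF assms(2)] by simp
  then have "ev (subs Var (IsN t)) tt" unfolding valid_def by (elim allE[of _ Var]) simp
  then obtain k where "ev t k" by auto
  then have "\<forall>\<^sub>F s in sequentially. eval code s t k" by (rule ev_imp_eval)
  then show ?thesis by (auto simp: eventually_sequentially)
qed

end
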